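(* Let $\mathcal{V}=\{\phi_\Lambda\}_{\Lambda\in\mathcal{C}}$ be a positive, continuous, $T$-invariant specification on $X=S^{\mathbb{Z}}$ with specification sequence $\{[0,n],f_n\}_{n=0}^\infty$. If $$\sum_{k=0}^\infty\prod_{j=0}^k\inf_{i\geq0}\bar r_{(-\infty,i+j]}(f_i)=\infty,$$ then $$g_{\mathcal{V}}(x)=\lim_{n\to\infty}\pi^{\mathcal{V}}_{[0,n]}\bigl([x]_{\{0\}}\,\big|\,x\bigr)$$ is well defined (for all $x\in X$), the convergence is uniform in $x$, and it determines a positive function $g_{\mathcal{V}}\in\mathcal{G}_X\cap C(X)$ such that $$r_{[-n,0]}(g_{\mathcal{V}})\leq\bigl(1+R_n^{-1}\bigr)^2\qquad(n\ge0),$$ where $$R_n=\sum_{k=0}^\infty\prod_{j=0}^k\inf_{i\geq0}\bar r_{[-n,i+j]}(f_i)\qquad(n\geq0).$$ Moreover, a probability measure $\mu$ on $X$ is a Gibbs state for $\mathcal{V}$ if and only if $\mu$ is a $g_{\mathcal{V}}$-chain.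
   Context: $S$ is a finite set with the discrete topology, $X=S^{\mathbb{Z}}$ has the product topology, and $\mathcal{B}$ is its Borel $\sigma$-algebra; $B(X)$ is the set of bounded Borel functions and $C(X)$ the set of continuous functions on $X$. $\mathcal{C}$ is the set of finite non-empty subsets of $\mathbb{Z}$. Intervals denote sets of integers. For $\Lambda\subseteq\mathbb{Z}$, $x_\Lambda$ is the projection of $x$ onto $S^\Lambda$, $[x]_\Lambda=\{y\in X:y_\Lambda=x_\Lambda\}$, $\Lambda^c=\mathbb{Z}\setminus\Lambda$, and $\mathcal{B}_\Lambda$ is the sub-$\sigma$-algebra of $\mathcal{B}$ generated by the coordinates in $\Lambda$. $\mathbb{Z}^-$ is the set of non-positive integers. $(s_0x)_0=s$ and $(s_0x)_i=x_i$ for $i\ne0$. $T$ is the shift, $(Tx)_j=x_{j+1}$. A specification on $X$ is a collection $\mathcal{V}=\{\phi_\Lambda\}_{\Lambda\in\mathcal{C}}$ of non-negative Borel functions on $X$ such that for all $\Lambda\in\mathcal{C}$ and $x\in X$, $\sum_{y\in[x]_{\Lambda^c}}\phi_\Lambda(y)=1$, and for all non-empty $K\subseteq\Lambda$, $\phi_\Lambda(x)=\phi_K(x)\sum_{y\in[x]_{K^c}}\phi_\Lambda(y)$. It is continuous if every $\phi_\Lambda$ is continuous, positive if every $\phi_\Lambda>0$, and $T$-invariant if $\phi_{i+\Lambda}(x)=\phi_\Lambda(T^ix)$ for all $i,\Lambda,x$. Put $\pi^{\mathcal{V}}_\Lambda(h\,|\,x)=\sum_{y\in[x]_{\Lambda^c}}\phi_\Lambda(y)h(y)$,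 so that $\pi^{\mathcal{V}}_{[0,n]}([x]_{\{0\}}\,|\,x)=\sum_{y\in[x]_{[0,n]^c},\,y_0=x_0}\phi_{[0,n]}(y)$. A Gibbs state for $\mathcal{V}$ is a probability measure $\mu$ on $(X,\mathcal{B})$ such that for all $\Lambda\in\mathcal{C}$, $\mu([x]_\Lambda\,|\,\mathcal{B}_{\Lambda^c})(x)=\phi_\Lambda(x)$ for $\mu$-a.e. $x$ (the left side is the value at $x$ of the conditional probability of the cylinder $\{y:y_\Lambda=\xi\}$ with $\xi=x_\Lambda$). A specification sequence $\{[0,n],f_n\}_{n=0}^\infty$ consists of positive functions $f_n\in B(X)$ with $f_n$ being $\mathcal{B}_{\mathbb{Z}\setminus[0,n-1]}$-measurable ($f_0$ is just Borel). It is a specification sequence for $\mathcal{V}$ if $\phi_{[0,n]}(x)=\bigl(\prod_{j=0}^nf_j(x)\bigr)\bigl(\sum_{y\in[x]_{[0,n]^c}}\prod_{j=0}^nf_j(y)\bigr)^{-1}$ for all $n\ge0$, $x\in X$. For a positive function $h$ on $X$ and $\Lambda\subseteq\mathbb{Z}$, $r_\Lambda(h)=\sup\{h(x)/h(y):x_\Lambda=y_\Lambda\}$ and $\bar r_\Lambda(h)=\inf\{h(x)/h(y):x_\Lambda=y_\Lambda\}$. Conventions: $\infty^{-1}=0$, $0^{-1}=\infty$. $\mathcal{G}_X$ is the set of $g\in B(X)$ that are $\mathcal{B}_{\mathbb{Z}^-}$-measurable with $g\ge0$ and $\sum_{s\in S}g(s_0x)=1$ for all $x\in X$. For $g\in\mathcal{G}_X$,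 a probability measure $\mu$ on $X$ is a $g$-chain if $\mu([x]_{\{n\}}\,|\,\mathcal{B}_{(-\infty,n-1]})(x)=g(T^nx)$ for $\mu$-a.e. $x$, for all $n\in\mathbb{Z}$. *)

theory Defs
  imports "HOL-Probability.Probability"
begin

text \<open>
  The finite set S is rendered as a type of class \<open>finite\<close> carrying the discrete topology, so that
  X is the function type \<open>int \<Rightarrow> 's\<close> with the library's product topology, and its Borel
  sigma-algebra is \<open>borel\<close>.
\<close>

type_synonym 's config = "int \<Rightarrow> 's"

definition agree :: "int set \<Rightarrow> 's config \<Rightarrow> 's config \<Rightarrow> bool" where
  "agree \<Lambda> x y \<longleftrightarrow> (\<forall>i\<in>\<Lambda>. x i = y i)"

definition cyl :: "int set \<Rightarrow> 's config \<Rightarrow> 's config set" where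
  "cyl \<Lambda> x = {y. agree \<Lambda> y x}"

definition finite_nonempty :: "int set set" where
  "finite_nonempty = {\<Lambda>. finite \<Lambda> \<and> \<Lambda> \<noteq> {}}"

text \<open>The sigma-algebra generated by the coordinates in \<open>\<Lambda>\<close>; only its space and sets matter.\<close>

definition coord_algebra :: "int set \<Rightarrow> 's config measure" where
  "coord_algebra \<Lambda> = sigma UNIV {{x. x i = s} | i s. i \<in> \<Lambda>}"

definition bounded_borel :: "('s::topological_space config \<Rightarrow> real) set" where
  "bounded_borel = {h. h \<in> borel_measurable borel \<and> bounded (range h)}"

definition shift :: "'s config \<Rightarrow> 's config" where
  "shift x = (\<lambda>j. x (j + 1))"

text \<open>Integer powers of the (invertible) shift.\<close>

definition shift_pow :: "int \<Rightarrow> 's config \<Rightarrow> 's config" where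
  "shift_pow i x = (\<lambda>j. x (j + i))"

lemma shift_pow_of_nat: "shift_pow (int n) = shift ^^ n"
  by (induction n) (auto simp: shift_pow_def shift_def fun_eq_iff add_ac)

lemma shift_pow_uminus: "shift_pow (- int n) = inv (shift ^^ n)"
  unfolding shift_pow_of_nat [symmetric]
  by (rule sym, rule inv_equality) (auto simp: shift_pow_def)

text \<open>
  In the following definitions the sums over \<open>cyl (- \<Lambda>) x\<close> are only used for finite \<open>\<Lambda>\<close>, where
  they have finitely many terms. Only the values of \<open>\<phi>\<close> at finite non-empty sets are relevant.
\<close>

definition is_specification :: "(int set \<Rightarrow> 's::{finite,discrete_topology} config \<Rightarrow> real) \<Rightarrow> bool" where
  "is_specification \<phi> \<longleftrightarrow>
     (\<forall>\<Lambda>\<in>finite_nonempty. \<phi> \<Lambda> \<in> borel_measurable borel) \<and>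
     (\<forall>\<Lambda>\<in>finite_nonempty. \<forall>x. \<phi> \<Lambda> x \<ge> 0) \<and>
     (\<forall>\<Lambda>\<in>finite_nonempty. \<forall>x. (\<Sum>y\<in>cyl (- \<Lambda>) x. \<phi> \<Lambda> y) = 1) \<and>
     (\<forall>\<Lambda>\<in>finite_nonempty. \<forall>x. \<forall>K. K \<noteq> {} \<and> K \<subseteq> \<Lambda> \<longrightarrow>
        \<phi> \<Lambda> x = \<phi> K x * (\<Sum>y\<in>cyl (- K) x. \<phi> \<Lambda> y))"

definition continuous_spec :: "(int set \<Rightarrow> 's::{finite,discrete_topology} config \<Rightarrow> real) \<Rightarrow> bool" where
  "continuous_spec \<phi> \<longleftrightarrow> (\<forall>\<Lambda>\<in>finite_nonempty. continuous_on UNIV (\<phi> \<Lambda>))"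

definition positive_spec :: "(int set \<Rightarrow> 's config \<Rightarrow> real) \<Rightarrow> bool" where
  "positive_spec \<phi> \<longleftrightarrow> (\<forall>\<Lambda>\<in>finite_nonempty. \<forall>x. \<phi> \<Lambda> x > 0)"

definition shift_invariant_spec :: "(int set \<Rightarrow> 's config \<Rightarrow> real) \<Rightarrow> bool" where
  "shift_invariant_spec \<phi> \<longleftrightarrow>
     (\<forall>i. \<forall>\<Lambda>\<in>finite_nonempty. \<forall>x. \<phi> ((+) i ` \<Lambda>) x = \<phi> \<Lambda> (shift_pow i x))"

definition spec_kernel ::
    "(int set \<Rightarrow> 's config \<Rightarrow> real) \<Rightarrow> int set \<Rightarrow> ('s config \<Rightarrow> real) \<Rightarrow> 's config \<Rightarrow> real" where
  "spec_kernel \<phi> \<Lambda> h x = (\<Sum>y\<in>cyl (- \<Lambda>) x. \<phi> \<Lambda> y * h y)"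

definition prob_measure_on_X :: "'s::topological_space config measure \<Rightarrow> bool" where
  "prob_measure_on_X \<mu> \<longleftrightarrow> prob_space \<mu> \<and> sets \<mu> = sets borel"

text \<open>
  The conditional probability of \<open>A\<close> given \<open>F\<close> is the library's \<open>real_cond_exp \<mu> F (indicator A)\<close>.
  Below the event \<open>cyl \<Lambda> x\<close> depends on the evaluation point \<open>x\<close>, but only through the finitely many
  patterns on the finite set \<open>\<Lambda>\<close>, so the almost-everywhere statement does not depend on the
  choice of versions.
\<close>

definition gibbs_state ::
    "(int set \<Rightarrow> 's::{finite,discrete_topology} config \<Rightarrow> real) \<Rightarrow> 's config measure \<Rightarrow> bool" where
  "gibbs_state \<phi> \<mu> \<longleftrightarrow> prob_measure_on_X \<mu> \<and>
     (\<forall>\<Lambda>\<in>finite_nonempty. AE x in \<mu>.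
        real_cond_exp \<mu> (coord_algebra (- \<Lambda>)) (indicator (cyl \<Lambda> x)) x = \<phi> \<Lambda> x)"

text \<open>For \<open>n = 0\<close> the set \<open>{0..<int n}\<close> is empty, so \<open>f 0\<close> is merely Borel.\<close>

definition spec_sequence :: "(nat \<Rightarrow> 's::{finite,discrete_topology} config \<Rightarrow> real) \<Rightarrow> bool" where
  "spec_sequence f \<longleftrightarrow>
     (\<forall>n. f n \<in> bounded_borel \<and> (\<forall>x. f n x > 0) \<and>
          f n \<in> borel_measurable (coord_algebra (- {0..<int n})))"

definition spec_sequence_for ::
    "(int set \<Rightarrow> 's::{finite,discrete_topology} config \<Rightarrow> real) \<Rightarrow>
     (nat \<Rightarrow> 's config \<Rightarrow> real) \<Rightarrow> bool" where
  "spec_sequence_for \<phi> f \<longleftrightarrow> spec_sequence f \<and>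
     (\<forall>n x. \<phi> {0..int n} x =
        (\<Prod>j\<le>n. f j x) * inverse (\<Sum>y\<in>cyl (- {0..int n}) x. \<Prod>j\<le>n. f j y))"

text \<open>
  Variations of a positive function, in \<open>[0, \<infinity>]\<close>; in \<open>ennreal\<close> one has
  \<open>inverse \<infinity> = 0\<close> and \<open>inverse 0 = \<infinity>\<close>.
\<close>

definition rsup :: "int set \<Rightarrow> ('s config \<Rightarrow> real) \<Rightarrow> ennreal" where
  "rsup \<Lambda> h = Sup {ennreal (h x / h y) | x y. agree \<Lambda> x y}"

definition rinf :: "int set \<Rightarrow> ('s config \<Rightarrow> real) \<Rightarrow> ennreal" where
  "rinf \<Lambda> h = Inf {ennreal (h x / h y) | x y. agree \<Lambda> x y}"

definition G_functions :: "('s::{finite,discrete_topology} config \<Rightarrow> real) set" where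
  "G_functions = {g. g \<in> bounded_borel \<and> g \<in> borel_measurable (coord_algebra {..0}) \<and>
     (\<forall>x. g x \<ge> 0) \<and> (\<forall>x. (\<Sum>s\<in>UNIV. g (x(0 := s))) = 1)}"

definition g_chain ::
    "('s::{finite,discrete_topology} config \<Rightarrow> real) \<Rightarrow> 's config measure \<Rightarrow> bool" where
  "g_chain g \<mu> \<longleftrightarrow> prob_measure_on_X \<mu> \<and>
     (\<forall>n. AE x in \<mu>.
        real_cond_exp \<mu> (coord_algebra {..n - 1}) (indicator (cyl {n} x)) x = g (shift_pow n x))"

definition g_approx :: "(int set \<Rightarrow> 's config \<Rightarrow> real) \<Rightarrow> nat \<Rightarrow> 's config \<Rightarrow> real" where
  "g_approx \<phi> n x = spec_kernel \<phi> {0..int n} (indicator (cyl {0} x)) x"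

definition g_of_spec :: "(int set \<Rightarrow> 's config \<Rightarrow> real) \<Rightarrow> 's config \<Rightarrow> real" where
  "g_of_spec \<phi> x = lim (\<lambda>n. g_approx \<phi> n x)"

definition R_sum :: "(nat \<Rightarrow> 's config \<Rightarrow> real) \<Rightarrow> nat \<Rightarrow> ennreal" where
  "R_sum f n = (\<Sum>k. \<Prod>j\<le>k. INF i. rinf {- int n..int i + int j} (f i))"

end

theory Submission
  imports Defs
begin

text \<open>
  Fix a past and sum the weight \<open>f\<^sub>0 \<cdot> \<dots> \<cdot> f\<^sub>n\<close> over the sites \<open>0, \<dots>, n\<close>, once for each of two observables
  \<open>F\<close>, \<open>G\<close> of the symbol at \<open>0\<close>; the site \<open>n\<close> is added to the sum after the sites \<open>< n\<close>, and \<open>f\<^sub>n\<close>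
  does not see them. Let \<open>m\<^sub>K\<close> be the infimum over all futures of the quotient \<open>F/G\<close> on the first \<open>K\<close>
  sites and let \<open>r\<^sub>K\<close> be the same quotient for the weights minimised over the future, so that \<open>r\<^sub>K\<close> does
  not depend on the future. With \<open>u\<^sub>i = c\<^sub>0 \<cdot> \<dots> \<cdot> c\<^sub>i\<^sub>-\<^sub>1\<close> one has the renewal inequality
  \<open>m\<^sub>K \<ge> \<Sum>\<^sub>M\<^sub><\<^sub>K (u\<^sub>K\<^sub>-\<^sub>1\<^sub>-\<^sub>M - u\<^sub>K\<^sub>-\<^sub>M) m\<^sub>M + u\<^sub>K r\<^sub>K\<close>. Summed over \<open>K\<close> it gives
  \<open>(1 + R) m\<^sub>n \<ge> \<Sum>\<^sub>K u\<^sub>K r\<^sub>K\<close>. The same bound with \<open>F\<close> and \<open>G\<close> exchanged has \<open>1/r\<^sub>K\<close> in place of \<open>r\<^sub>K\<close>, and by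
  Cauchy-Schwarz the cross ratio of \<open>F/G\<close> between any two futures is at least \<open>(R/(1+R))\<^sup>2\<close>. If \<open>R\<close>
  diverges, the approximations of \<open>g\<close> are uniformly Cauchy; applied with finite pasts, the same inequality
  bounds the variation of \<open>g\<close>.

  Gibbs states are the measures invariant under all kernels of the specification, and \<open>g\<close>-chains are the
  measures invariant under the one-site kernels of \<open>g\<close>. The kernel of \<open>[n, n+N]\<close> applied to a function of
  the coordinates \<open>\<le> n\<close> converges uniformly to the one-site kernel at \<open>n\<close>, which gives one implication.
  Iterating, the kernel of \<open>[m, L]\<close> converges to a product of one-site kernels, so under a \<open>g\<close>-chain it
  is asymptotically measure preserving; consistency of the kernels gives the other implication.
\<close>

section \<open>Partition sums and their ratios\<close>

text \<open>Site \<open>m\<close> is summed outside the sites below \<open>m\<close>, so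
  \<open>w m\<close> reads their original values. The recursion is the full sum over the sites
  \<open>0, ..., n - 1\<close> as soon as each \<open>w m\<close> ignores the sites in
  \<open>[0, m)\<close>.\<close>

primrec partition_sum ::
    "(nat \<Rightarrow> 's::finite config \<Rightarrow> real) \<Rightarrow> ('s config \<Rightarrow> real) \<Rightarrow> nat \<Rightarrow> 's config \<Rightarrow> real" where
  "partition_sum w h 0 x = h x"
| "partition_sum w h (Suc m) x = (\<Sum>b\<in>UNIV. w m (x(int m := b)) * partition_sum w h m (x(int m := b)))"

text \<open>These conditions cover the indicator of a symbol at \<open>0\<close> as well as the
  constant \<open>1\<close>, so every estimate can be used with numerator and denominator
  exchanged.\<close>

definition site_observable :: "('s config \<Rightarrow> real) \<Rightarrow> bool" where
  "site_observable h \<longleftrightarrow> (\<forall>x. 0 \<le> h x) \<and> (\<forall>x y. x 0 = y 0 \<longrightarrow> h x = h y) \<and> (\<exists>x. 0 < h x)"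

lemma site_observable_nonneg: "site_observable h \<Longrightarrow> 0 \<le> h x"
  and site_observable_cong: "site_observable h \<Longrightarrow> x 0 = y 0 \<Longrightarrow> h x = h y"
  and site_observable_exists: "site_observable h \<Longrightarrow> \<exists>x. 0 < h x"
  unfolding site_observable_def by blast+

lemma agree_refl [simp]: "agree A x x"
  by (simp add: agree_def)

lemma agree_sym: "agree A x y \<Longrightarrow> agree A y x"
  by (simp add: agree_def)

lemma agree_trans: "agree A x y \<Longrightarrow> agree A y z \<Longrightarrow> agree A x z"
  by (simp add: agree_def)

lemma agreeD: "agree A x y \<Longrightarrow> i \<in> A \<Longrightarrow> x i = y i"
  by (simp add: agree_def)

lemma agreeI: "(\<And>i. i \<in> A \<Longrightarrow> x i = y i) \<Longrightarrow> agree A x y"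
  by (simp add: agree_def)

lemma agree_cong: "agree A x y \<Longrightarrow> agree A x = agree A y"
  by (intro ext iffI) (erule agree_trans[OF agree_sym], assumption, erule agree_trans, assumption)

lemma agree_mono: "agree A x y \<Longrightarrow> B \<subseteq> A \<Longrightarrow> agree B x y"
  by (auto simp: agree_def)

lemma partition_sum_nonneg:
  assumes "\<And>i x. 0 \<le> w i x" "site_observable h"
  shows "0 \<le> partition_sum w h m x"
  using assms(1) by (induction m arbitrary: x)
    (auto simp: site_observable_nonneg[OF assms(2)] intro!: sum_nonneg mult_nonneg_nonneg)

text \<open>At least one site must be summed, because \<open>h\<close> itself may vanish; the sum
  over site \<open>0\<close> meets a symbol where \<open>h\<close> is positive.\<close>

lemma partition_sum_pos:
  assumes w: "\<And>i x. 0 < w i x" and h: "site_observable h"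
  shows "0 < partition_sum w h (Suc m) x"
proof (induction m arbitrary: x)
  case 0
  obtain z where z: "0 < h z" using site_observable_exists[OF h] by blast
  have "h (x(0 := z 0)) = h z" by (rule site_observable_cong[OF h]) simp
  then have "0 < w 0 (x(0 := z 0)) * h (x(0 := z 0))" using z w by simp
  moreover have "0 \<le> w 0 (x(0 := b)) * h (x(0 := b))" for b
    using w site_observable_nonneg[OF h] by (simp add: less_imp_le)
  ultimately show ?case
    by (auto intro!: sum_pos2[of _ "z 0"])
next
  case (Suc m)
  show ?case unfolding partition_sum.simps(2)[of _ _ "Suc m"]
    by (intro sum_pos mult_pos_pos w Suc) auto
qed

lemma partition_sum_weight_cong:
  assumes "\<And>i. i < M \<Longrightarrow> v i = w i"
  shows "partition_sum v h M x = partition_sum w h M x"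
  using assms by (induction M arbitrary: x) auto

text \<open>The sites below \<open>M\<close> are overwritten by the summation, so only
  \<open>P\<close> and the sites in \<open>[M, K)\<close> remain visible. For \<open>M = K\<close>
  nothing but \<open>P\<close> is left.\<close>

lemma partition_sum_cong:
  assumes w: "\<And>i x y. i < K \<Longrightarrow> agree (P \<union> {int i..<int K}) x y \<Longrightarrow> w i x = w i y"
    and h: "site_observable h" and "0 < K" "P \<subseteq> {..<0}"
  shows "M \<le> K \<Longrightarrow> agree (P \<union> {int M..<int K}) x y \<Longrightarrow> partition_sum w h M x = partition_sum w h M y"
proof (induction M arbitrary: x y)
  case 0
  have "x 0 = y 0" by (rule agreeD[OF 0(2)]) (simp add: \<open>0 < K\<close>)
  then show ?case unfolding partition_sum.simps by (rule site_observable_cong[OF h])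
next
  case (Suc M)
  have ag: "agree (P \<union> {int M..<int K}) (x(int M := b)) (y(int M := b))" for b
    using agreeD[OF Suc.prems(2)] by (intro agreeI) auto
  have "w M (x(int M := b)) * partition_sum w h M (x(int M := b)) =
      w M (y(int M := b)) * partition_sum w h M (y(int M := b))" for b
    using Suc.prems(1) by (intro arg_cong2[where f = "(*)"] w[OF _ ag] Suc.IH[OF _ ag]) auto
  then show ?case by simp
qed

text \<open>\<open>c j\<close> bounds the ratio of two values of any \<open>f i\<close> from below
  when the arguments share \<open>P\<close> and the \<open>j + 1\<close> sites starting at
  \<open>i\<close>. \<open>P\<close> will be the set of all negative sites for the existence of the
  limit, and a finite block for the bound on its variation.\<close>

locale weights =
  fixes P :: "int set" and f :: "nat \<Rightarrow> 's::finite config \<Rightarrow> real" and c :: "nat \<Rightarrow> real"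
  assumes P_neg: "P \<subseteq> {..<0}"
    and f_pos: "0 < f i x"
    and c_pos: "0 < c j"
    and c_le: "c j \<le> 1"
    and f_var: "agree (P \<union> {int i..int i + int j}) x y \<Longrightarrow> c j * f i x \<le> f i y"
begin

text \<open>The weight minimised over everything outside \<open>P\<close> and the window
  \<open>[i, K)\<close>. Once \<open>K\<close> sites have been summed, its partition sums no longer
  depend on the future.\<close>

definition inf_weight :: "nat \<Rightarrow> nat \<Rightarrow> 's config \<Rightarrow> real" where
  "inf_weight K i x = (INF y\<in>{y. agree (P \<union> {int i..<int K}) x y}. f i y)"

lemma inf_weight_le: "inf_weight K i x \<le> f i x"
  unfolding inf_weight_def
  by (rule cINF_lower) (simp_all add: bdd_belowI2[where m = 0] less_imp_le f_pos)

text \<open>The window \<open>[i, K)\<close> has \<open>(K - 1 - i) + 1\<close> sites, hence the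
  index of \<open>c\<close>.\<close>

lemma le_inf_weight: "i < K \<Longrightarrow> c (K - 1 - i) * f i x \<le> inf_weight K i x"
  unfolding inf_weight_def
proof (rule cINF_greatest)
  show "{y. agree (P \<union> {int i..<int K}) x y} \<noteq> {}" using agree_refl by blast
  fix y assume "i < K" "y \<in> {y. agree (P \<union> {int i..<int K}) x y}"
  then have "agree (P \<union> {int i..int i + int (K - 1 - i)}) x y"
    by (auto elim: agree_mono)
  then show "c (K - 1 - i) * f i x \<le> f i y" by (rule f_var)
qed

lemma inf_weight_pos: "0 < inf_weight K i x" if "i < K"
  using mult_pos_pos[OF c_pos f_pos] le_inf_weight[OF that] by (rule less_le_trans)

lemma inf_weight_cong: "agree (P \<union> {int i..<int K}) x y \<Longrightarrow> inf_weight K i x = inf_weight K i y"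
  by (simp add: inf_weight_def agree_cong)

text \<open>The renewal weights, with \<open>u 0 = 1\<close>; a product of \<open>c j\<close> over
  \<open>j \<le> k\<close> is \<open>u (Suc k)\<close>.\<close>

definition u :: "nat \<Rightarrow> real" where
  "u i = (\<Prod>j<i. c j)"

lemma u_0 [simp]: "u 0 = 1" and u_Suc: "u (Suc i) = u i * c i"
  by (simp_all add: u_def)

lemma u_pos: "0 < u i"
  by (simp add: u_def prod_pos c_pos)

lemma partition_sum_f_pos: "site_observable h \<Longrightarrow> 0 < M \<Longrightarrow> 0 < partition_sum f h M x"
  using partition_sum_pos[of f h "M - 1" x] f_pos by simp

lemma partition_sum_f_nonneg: "site_observable h \<Longrightarrow> 0 \<le> partition_sum f h M x"
  by (rule partition_sum_nonneg) (simp_all add: less_imp_le f_pos)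

lemma partition_sum_inf_weight_pos:
  assumes "site_observable h" "0 < K"
  shows "0 < partition_sum (inf_weight K) h K x"
proof -
  \<comment> \<open>Positivity of \<open>inf_weight K i\<close> is known only for
    \<open>i < K\<close>. The other weights are not read by a sum over \<open>K\<close> sites and
    may be set to \<open>1\<close>.\<close>
  have "partition_sum (inf_weight K) h K x = partition_sum (\<lambda>i. if i < K then inf_weight K i else (\<lambda>_. 1)) h K x"
    by (rule partition_sum_weight_cong) auto
  also have "\<dots> > 0"
    using partition_sum_pos[of "\<lambda>i. if i < K then inf_weight K i else (\<lambda>_. 1)" h "K - 1" x] inf_weight_pos assms by auto
  finally show ?thesis .
qed

lemma agree_update: "agree P z x \<Longrightarrow> agree P z (x(int m := b))"
  using P_neg by (intro agreeI) (auto dest: agreeD)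

text \<open>One more site means a combination with non-negative coefficients \<open>f M\<close>, the
  same for \<open>F\<close> and for \<open>G\<close>, and a linear inequality survives it.\<close>

lemma bound_propagates_step:
  assumes "\<And>x. agree P z x \<Longrightarrow> a * partition_sum f G M x \<le> partition_sum f F M x" "agree P z x"
  shows "a * partition_sum f G (Suc M) x \<le> partition_sum f F (Suc M) x"
  unfolding partition_sum.simps sum_distrib_left
proof (rule sum_mono)
  fix b
  show "a * (f M (x(int M := b)) * partition_sum f G M (x(int M := b)))
      \<le> f M (x(int M := b)) * partition_sum f F M (x(int M := b))"
    using mult_left_mono[OF assms(1)[OF agree_update[OF assms(2)], of M b]
        less_imp_le[OF f_pos[of M "x(int M := b)"]]]
    by (simp only: mult.left_commute)
qed

lemma bound_propagates:
  assumes "\<And>x. agree P z x \<Longrightarrow> a * partition_sum f G M x \<le> partition_sum f F M x" "M \<le> N" "agree P z x"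
  shows "a * partition_sum f G N x \<le> partition_sum f F N x"
  using assms(2,3)
proof (induction N arbitrary: x rule: dec_induct)
  case base
  then show ?case by (rule assms(1))
next
  case (step N)
  show ?case by (rule bound_propagates_step[OF step.IH step.prems])
qed

text \<open>
  The summands of the right-hand side may be negative. Mixing the sharper slope \<open>b\<close> with the
  guaranteed slope \<open>a\<close> in the proportion given by \<open>c\<close> is what allows \<open>f\<close> to be replaced by its infimum
  in both cases: by \<open>inf_weight \<le> f\<close> if the summand is positive, by \<open>c f \<le> inf_weight\<close> if not.
\<close>

lemma truncated_comparison_step:
  assumes F: "site_observable F" and G: "site_observable G" and M: "M < K" and le: "a \<le> b"
    and low: "\<And>x. agree P z x \<Longrightarrow> a * partition_sum f G M x \<le> partition_sum f F M x"
    and cmp: "\<And>x. agree P z x \<Longrightarrow>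
      partition_sum (inf_weight K) F M x - r * partition_sum (inf_weight K) G M x \<le> partition_sum f F M x - b * partition_sum f G M x"
    and x: "agree P z x"
  defines "c' \<equiv> c (K - 1 - M)"
  shows "partition_sum (inf_weight K) F (Suc M) x - r * partition_sum (inf_weight K) G (Suc M) x
    \<le> partition_sum f F (Suc M) x - ((1 - c') * a + c' * b) * partition_sum f G (Suc M) x"
proof -
  have "inf_weight K M (x(int M := s)) * partition_sum (inf_weight K) F M (x(int M := s)) -
      r * (inf_weight K M (x(int M := s)) * partition_sum (inf_weight K) G M (x(int M := s)))
    \<le> f M (x(int M := s)) * partition_sum f F M (x(int M := s)) -
      ((1 - c') * a + c' * b) * (f M (x(int M := s)) * partition_sum f G M (x(int M := s)))" for s
  proof -
    define y where "y = x(int M := s)"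
    have y: "agree P z y" unfolding y_def by (rule agree_update[OF x])
    \<comment> \<open>\<open>N\<close> and \<open>X\<close> are the slacks of the guaranteed slope
      \<open>a\<close> and of the sharper slope \<open>b\<close>; the slack of the mixed slope is
      \<open>(1 - c') * N + c' * X\<close>.\<close>
    define N X where "N = partition_sum f F M y - a * partition_sum f G M y" and "X = partition_sum f F M y - b * partition_sum f G M y"
    have N: "0 \<le> N" using low[OF y] by (simp add: N_def)
    have "0 \<le> partition_sum f G M y" by (rule partition_sum_f_nonneg[OF G])
    then have XN: "X \<le> N" using le by (simp add: X_def N_def mult_right_mono)
    have c': "0 < c'" "c' \<le> 1" using c_pos c_le by (auto simp: c'_def)
    have d: "0 < inf_weight K M y" "inf_weight K M y \<le> f M y" "c' * f M y \<le> inf_weight K M y"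
      using inf_weight_pos[OF M] inf_weight_le le_inf_weight[OF M] by (auto simp: c'_def)
    have "inf_weight K M y * (partition_sum (inf_weight K) F M y - r * partition_sum (inf_weight K) G M y) \<le> inf_weight K M y * X"
      using cmp[OF y] d(1) unfolding X_def by (intro mult_left_mono) auto
    also have "\<dots> \<le> f M y * ((1 - c') * N + c' * X)"
    proof (cases "0 \<le> X")
      case True
      have "inf_weight K M y * X \<le> f M y * X" using True d by (intro mult_right_mono) auto
      also have "\<dots> \<le> f M y * ((1 - c') * N + c' * X)"
      proof (rule mult_left_mono)
        have "(1 - c') * X \<le> (1 - c') * N" using XN c' by (intro mult_left_mono) auto
        then show "X \<le> (1 - c') * N + c' * X" by (simp add: algebra_simps)
      qed (use f_pos[of M y] in simp)
      finally show ?thesis .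
    next
      case False
      have "inf_weight K M y * X \<le> (c' * f M y) * X" using False d by (intro mult_right_mono_neg) auto
      also have "\<dots> \<le> f M y * ((1 - c') * N) + f M y * (c' * X)"
        using N c' f_pos[of M y] by simp
      finally show ?thesis by (simp add: distrib_left)
    qed
    finally show ?thesis unfolding y_def[symmetric] N_def X_def by (simp add: algebra_simps)
  qed
  then show ?thesis
    unfolding partition_sum.simps sum_distrib_left sum_subtractf[symmetric] by (rule sum_mono)
qed

text \<open>The comparison with the minimised weights starts as an equality with slope
  \<open>r\<close> and pays for each site by mixing the slope with \<open>m M\<close>. After
  \<open>K\<close> sites the minimised sums depend on \<open>P\<close> alone, so by the choice of
  \<open>r\<close> they cancel and only the bound with the final slope \<open>\<xi>\<close>
  remains.\<close>

lemma truncated_comparison: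
  fixes m :: "nat \<Rightarrow> real"
  assumes F: "site_observable F" and G: "site_observable G" and K: "0 < K" and z: "agree P z x"
    and mono: "\<And>M. m M \<le> m (Suc M)"
    and low: "\<And>M x. agree P z x \<Longrightarrow> m M * partition_sum f G M x \<le> partition_sum f F M x"
  defines "r \<equiv> partition_sum (inf_weight K) F K z / partition_sum (inf_weight K) G K z"
  defines "\<xi> \<equiv> (\<Sum>M<K. (u (K - 1 - M) - u (K - M)) * m M) + u K * r"
  shows "\<xi> * partition_sum f G K x \<le> partition_sum f F K x"
proof -
  \<comment> \<open>The slope after \<open>M\<close> sites, as produced by the one-site
    comparison.\<close>
  define g where "g = rec_nat r (\<lambda>M a. (1 - c (K - 1 - M)) * m M + c (K - 1 - M) * a)"
  have g_0: "g 0 = r" and g_Suc: "g (Suc M) = (1 - c (K - 1 - M)) * m M + c (K - 1 - M) * g M" for M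
    by (simp_all add: g_def)
  \<comment> \<open>The factor \<open>u (K - M)\<close> absorbs the factors \<open>c\<close>, so the
    recursion telescopes; it is \<open>1\<close> at \<open>M = K\<close>.\<close>
  have closed: "M \<le> K \<Longrightarrow>
    u (K - M) * g M = (\<Sum>i<M. (u (K - 1 - i) - u (K - i)) * m i) + u K * r" for M
  proof (induction M)
    case (Suc M)
    have eq: "K - M = Suc (K - 1 - M)" "K - Suc M = K - 1 - M" using Suc.prems by auto
    have u': "u (K - 1 - M) * c (K - 1 - M) = u (K - M)" unfolding eq(1) by (simp add: u_Suc)
    have "u (K - Suc M) * g (Suc M)
      = (u (K - 1 - M) - u (K - 1 - M) * c (K - 1 - M)) * m M + u (K - 1 - M) * c (K - 1 - M) * g M"
      unfolding g_Suc eq(2) by (simp add: algebra_simps)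
    also have "\<dots> = (u (K - 1 - M) - u (K - M)) * m M + u (K - M) * g M"
      unfolding u' ..
    finally show ?case using Suc by simp
  qed (simp add: g_0)
  have \<xi>: "g K = \<xi>" using closed[of K] by (simp add: \<xi>_def)
  \<comment> \<open>Once the slope has fallen to \<open>m M\<close> or below, it stays below the
    increasing sequence \<open>m\<close>. Until then \<open>m M\<close> can serve as the smaller,
    guaranteed slope of the one-site comparison.\<close>
  have "M \<le> K \<Longrightarrow> g M \<le> m M \<or> (\<forall>x. agree P z x \<longrightarrow>
      partition_sum (inf_weight K) F M x - r * partition_sum (inf_weight K) G M x \<le> partition_sum f F M x - g M * partition_sum f G M x)" for M
  proof (induction M)
    case 0
    then show ?case by (simp add: g_0)
  next
    case (Suc M)
    show ?case
    proof (cases "g M \<le> m M")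
      case True
      have "c (K - 1 - M) * g M \<le> c (K - 1 - M) * m M"
        using True c_pos[of "K - 1 - M"] by (intro mult_left_mono) auto
      then have "g (Suc M) \<le> m M" unfolding g_Suc by (simp add: algebra_simps)
      then show ?thesis using mono[of M] by auto
    next
      case False
      then have le: "m M \<le> g M" by simp
      have cmp: "\<And>x. agree P z x \<Longrightarrow>
          partition_sum (inf_weight K) F M x - r * partition_sum (inf_weight K) G M x \<le> partition_sum f F M x - g M * partition_sum f G M x"
        using Suc False by auto
      have "M < K" using Suc.prems by simp
      from truncated_comparison_step[OF F G this le low cmp] show ?thesis unfolding g_Suc by blast
    qed
  qed
  from this[of K] consider "g K \<le> m K" |
    "\<forall>x. agree P z x \<longrightarrow>
      partition_sum (inf_weight K) F K x - r * partition_sum (inf_weight K) G K x \<le> partition_sum f F K x - g K * partition_sum f G K x"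
    by auto
  then show ?thesis
  proof cases
    case 1
    have "0 \<le> partition_sum f G K x" by (rule partition_sum_f_nonneg[OF G])
    then have "\<xi> * partition_sum f G K x \<le> m K * partition_sum f G K x" using 1 by (simp add: \<xi> mult_right_mono)
    then show ?thesis using low[OF z, of K] by simp
  next
    case 2
    \<comment> \<open>All \<open>K\<close> sites are summed, so \<open>x\<close> may be replaced by
      \<open>z\<close>, at which \<open>r\<close> was formed.\<close>
    have eq: "partition_sum (inf_weight K) h K x = partition_sum (inf_weight K) h K z" if "site_observable h" for h
      by (rule partition_sum_cong[OF inf_weight_cong that K P_neg]) (simp_all add: agree_sym[OF z])
    have "partition_sum (inf_weight K) F K x - r * partition_sum (inf_weight K) G K x = 0"
      unfolding r_def eq[OF F] eq[OF G] using partition_sum_inf_weight_pos[OF G K, of z] by simp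
    then show ?thesis using 2[rule_format, OF z] by (simp add: \<xi>)
  qed
qed

end

section \<open>The renewal inequality and the cross-ratio bound\<close>

context weights
begin

definition R :: "nat \<Rightarrow> real" where
  "R n = (\<Sum>K=1..n. u K)"

lemma R_nonneg: "0 \<le> R n"
  unfolding R_def by (intro sum_nonneg less_imp_le u_pos)

text \<open>Passing from \<open>n\<close> to \<open>n + 1\<close> changes the convolution on the
  right by \<open>m (Suc n)\<close> minus the memory sum of the renewal inequality, hence by at
  least \<open>u (Suc n) * r (Suc n)\<close>.\<close>

lemma renewal_sum:
  fixes m r :: "nat \<Rightarrow> real"
  assumes "m 0 = 0"
    and "\<And>K. 0 < K \<Longrightarrow> (\<Sum>M<K. (u (K - 1 - M) - u (K - M)) * m M) + u K * r K \<le> m K"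
  shows "(\<Sum>K=1..n. u K * r K) \<le> (\<Sum>K=1..n. u (n - K) * m K)"
proof (induction n)
  case (Suc n)
  have shift: "(\<Sum>M<Suc n. g M) = (\<Sum>M=1..n. g M)" if "g 0 = (0::real)" for g
    unfolding sum.lessThan_Suc_shift One_nat_def sum.atLeast1_atMost_eq using that by simp
  have "(\<Sum>K=1..Suc n. u K * r K) \<le> (\<Sum>K=1..n. u (n - K) * m K) + u (Suc n) * r (Suc n)"
    using Suc by simp
  also have "(\<Sum>K=1..n. u (n - K) * m K) =
      (\<Sum>M=1..n. (u (n - M) - u (Suc n - M)) * m M) + (\<Sum>K=1..n. u (Suc n - K) * m K)"
    by (simp add: sum.distrib[symmetric] algebra_simps)
  also have "(\<Sum>M=1..n. (u (n - M) - u (Suc n - M)) * m M) =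
      (\<Sum>M<Suc n. (u (Suc n - 1 - M) - u (Suc n - M)) * m M)"
    by (subst shift) (simp_all add: assms(1))
  also have "\<dots> + (\<Sum>K=1..n. u (Suc n - K) * m K) + u (Suc n) * r (Suc n) \<le>
      m (Suc n) + (\<Sum>K=1..n. u (Suc n - K) * m K)"
    using assms(2)[of "Suc n"] by simp
  finally show ?case by simp
qed simp

text \<open>The best lower bounds \<open>m M\<close> of the quotient satisfy the renewal inequality
  and increase with \<open>M\<close>. Replacing every \<open>m K\<close> by \<open>m n\<close> in
  the summed inequality leaves at most \<open>(1 + R n) * m n\<close>.\<close>

lemma ratio_lower_bound:
  assumes F: "site_observable F" and G: "site_observable G" and n: "0 < n" and x: "agree P z x"
  shows "(\<Sum>K=1..n. u K * (partition_sum (inf_weight K) F K z / partition_sum (inf_weight K) G K z)) / (1 + R n) * partition_sum f G n x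
    \<le> partition_sum f F n x"
proof -
  define q where "q M x = partition_sum f F M x / partition_sum f G M x" for M x
  \<comment> \<open>With no site summed the denominator may vanish. The value \<open>0\<close> is
    still a valid bound, as \<open>F\<close> is non-negative, and it is the initial value for which
    the renewal inequality is summed.\<close>
  define m where "m M = (if M = 0 then 0 else INF x\<in>{x. agree P z x}. q M x)" for M
  define r where "r K = partition_sum (inf_weight K) F K z / partition_sum (inf_weight K) G K z" for K
  have Gpos: "0 < partition_sum f G M x" if "0 < M" for M x
    using partition_sum_f_pos[OF G that] .
  have bdd: "bdd_below (q M ` A)" for M A
    by (rule bdd_belowI2[where m = 0]) (simp add: q_def partition_sum_f_nonneg F G)
  have greatest: "a \<le> m M" if "0 < M" "\<And>x. agree P z x \<Longrightarrow> a * partition_sum f G M x \<le> partition_sum f F M x" for a M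
  proof -
    have "a \<le> (INF x\<in>{x. agree P z x}. q M x)"
    proof (rule cINF_greatest)
      show "{x. agree P z x} \<noteq> {}" using agree_refl by blast
    qed (use that Gpos[OF that(1)] in \<open>simp add: q_def pos_le_divide_eq\<close>)
    then show ?thesis using that(1) by (simp add: m_def)
  qed
  have low: "m M * partition_sum f G M x \<le> partition_sum f F M x" if "agree P z x" for M x
  proof (cases "M = 0")
    case True
    then show ?thesis using partition_sum_f_nonneg[OF F, of M x] by (simp add: m_def)
  next
    case False
    have "m M \<le> q M x" using False that bdd by (auto simp: m_def intro: cINF_lower)
    then show ?thesis using Gpos[of M x] False by (simp add: q_def pos_le_divide_eq)
  qed
  have mono: "m M \<le> m (Suc M)" for M
    by (rule greatest) (auto intro!: bound_propagates_step[where z = z] low simp del: partition_sum.simps)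
  have m_le: "m i \<le> m j" if "i \<le> j" for i j
    using mono that by (rule lift_Suc_mono_le)
  have "0 \<le> m n" using m_le[of 0 n] by (simp add: m_def)
  have step: "(\<Sum>M<K. (u (K - 1 - M) - u (K - M)) * m M) + u K * r K \<le> m K" if "0 < K" for K
    unfolding r_def by (rule greatest[OF that]) (rule truncated_comparison[OF F G that _ mono low], assumption+)
  have "(\<Sum>K=1..n. u K * r K) \<le> (\<Sum>K=1..n. u (n - K) * m K)"
    by (rule renewal_sum[OF _ step]) (simp add: m_def)
  also have "\<dots> \<le> (\<Sum>K=1..n. u (n - K) * m n)"
    by (intro sum_mono mult_left_mono m_le) (auto simp: less_imp_le u_pos)
  also have "\<dots> = (\<Sum>K=1..n. u (n - K)) * m n"
    by (simp add: sum_distrib_right)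
  also have "(\<Sum>K=1..n. u (n - K)) = (\<Sum>i<n. u i)"
    by (rule sum.reindex_bij_witness[where i = "\<lambda>i. n - i" and j = "\<lambda>K. n - K"]) auto
  \<comment> \<open>The additional term \<open>u n\<close> serves only to reach the closed form
    \<open>1 + R n\<close>.\<close>
  also have "\<dots> \<le> (\<Sum>i<Suc n. u i)" using u_pos[of n] by simp
  also have "\<dots> = 1 + R n" by (simp add: R_def sum.lessThan_Suc_shift sum.atLeast1_atMost_eq del: sum.lessThan_Suc)
  finally have "(\<Sum>K=1..n. u K * r K) \<le> (1 + R n) * m n"
    using \<open>0 \<le> m n\<close> by (simp add: mult_right_mono)
  then have "(\<Sum>K=1..n. u K * r K) / (1 + R n) \<le> m n"
    using R_nonneg[of n] by (simp add: pos_divide_le_eq mult.commute)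
  then have "(\<Sum>K=1..n. u K * r K) / (1 + R n) * partition_sum f G n x \<le> m n * partition_sum f G n x"
    using Gpos[OF n, of x] by (intro mult_right_mono) simp_all
  then show ?thesis using low[OF x, of n] unfolding r_def by linarith
qed

text \<open>The unknown ratios \<open>r K\<close> occur inverted in the lower bound with
  \<open>F\<close> and \<open>G\<close> exchanged, so Cauchy-Schwarz removes them from the product
  of the two bounds and leaves \<open>(R n)\<close> squared.\<close>

lemma cross_ratio:
  assumes F: "site_observable F" and G: "site_observable G" and n: "0 < n" and x: "agree P z x" and y: "agree P z y"
  shows "(R n / (1 + R n))\<^sup>2 * (partition_sum f F n y * partition_sum f G n x) \<le> partition_sum f F n x * partition_sum f G n y"
proof -
  define r where "r K = partition_sum (inf_weight K) F K z / partition_sum (inf_weight K) G K z" for K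
  define A B where "A = (\<Sum>K=1..n. u K * r K)" and "B = (\<Sum>K=1..n. u K * (1 / r K))"
  have r: "0 < r K" if "0 < K" for K
    using partition_sum_inf_weight_pos[OF F that] partition_sum_inf_weight_pos[OF G that] by (simp add: r_def)
  have "R n = (\<Sum>K=1..n. sqrt (u K * r K) * sqrt (u K * (1 / r K)))"
    unfolding R_def
  proof (rule sum.cong)
    fix K assume "K \<in> {1..n}"
    then have "0 < r K" using r by auto
    then have "sqrt (u K * r K) * sqrt (u K * (1 / r K)) = sqrt (u K * u K)"
      by (simp add: real_sqrt_mult[symmetric])
    then show "u K = sqrt (u K * r K) * sqrt (u K * (1 / r K))"
      using u_pos[of K] by simp
  qed simp
  also have "\<dots>\<^sup>2 \<le> (\<Sum>K=1..n. (sqrt (u K * r K))\<^sup>2) * (\<Sum>K=1..n. (sqrt (u K * (1 / r K)))\<^sup>2)"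
    by (rule Cauchy_Schwarz_ineq_sum)
  also have "\<dots> = A * B"
    unfolding A_def B_def
    by (intro arg_cong2[where f = "(*)"] sum.cong refl real_sqrt_pow2 mult_nonneg_nonneg less_imp_le u_pos)
      (auto simp: r less_imp_le)
  finally have CS: "(R n)\<^sup>2 \<le> A * B" .
  have AB: "0 \<le> A" "0 \<le> B"
    unfolding A_def B_def by (intro sum_nonneg mult_nonneg_nonneg; simp add: less_imp_le u_pos r)+
  have Gx: "0 < partition_sum f h n x" if "site_observable h" for h x
    using partition_sum_f_pos[OF that n] .
  have R1: "0 < 1 + R n" using R_nonneg[of n] by simp
  have 1: "A / (1 + R n) * partition_sum f G n x \<le> partition_sum f F n x"
    using ratio_lower_bound[OF F G n x] by (simp add: A_def r_def)
  have 2: "B / (1 + R n) * partition_sum f F n y \<le> partition_sum f G n y"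
    using ratio_lower_bound[OF G F n y] by (simp add: B_def r_def)
  have "(R n / (1 + R n))\<^sup>2 * (partition_sum f F n y * partition_sum f G n x) \<le>
      (A * B / (1 + R n)\<^sup>2) * (partition_sum f F n y * partition_sum f G n x)"
    using CS Gx[OF F, of y] Gx[OF G, of x] R1
    by (intro mult_right_mono) (auto simp: power_divide divide_right_mono)
  also have "\<dots> = (A / (1 + R n) * partition_sum f G n x) * (B / (1 + R n) * partition_sum f F n y)"
    by (simp add: power2_eq_square)
  also have "\<dots> \<le> partition_sum f F n x * partition_sum f G n y"
    using AB Gx[OF F] Gx[OF G] R1
    by (intro mult_mono 1 2) (auto simp: less_imp_le)
  finally show ?thesis .
qed

end

section \<open>Cylinders and the approximations of the limit function\<close>

lemma mem_cyl_Compl: "y \<in> cyl (- \<Lambda>) x \<longleftrightarrow> (\<forall>i. i \<notin> \<Lambda> \<longrightarrow> y i = x i)"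
  by (auto simp: cyl_def agree_def)

lemma cyl_self [simp]: "x \<in> cyl A x"
  by (simp add: cyl_def)

lemma cyl_cong: "agree A x y \<Longrightarrow> cyl A x = cyl A y"
  unfolding cyl_def using agree_sym agree_trans by blast

lemma cyl_eqI: "y \<in> cyl A x \<Longrightarrow> cyl A y = cyl A x"
  by (rule cyl_cong) (simp add: cyl_def)

lemma cyl_UNIV [simp]: "cyl UNIV x = {x}"
  by (auto simp: cyl_def agree_def fun_eq_iff)

lemma cyl_Compl_insert: "cyl (- insert n \<Lambda>) x = (\<Union>s. cyl (- \<Lambda>) (x(n := s)))" if "n \<notin> \<Lambda>"
proof (rule set_eqI)
  fix y
  have "(\<forall>i. i \<notin> insert n \<Lambda> \<longrightarrow> y i = x i) \<longleftrightarrow> (\<exists>s. \<forall>i. i \<notin> \<Lambda> \<longrightarrow> y i = (x(n := s)) i)"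
  proof
    assume "\<forall>i. i \<notin> insert n \<Lambda> \<longrightarrow> y i = x i"
    then have "\<forall>i. i \<notin> \<Lambda> \<longrightarrow> y i = (x(n := y n)) i" by simp
    then show "\<exists>s. \<forall>i. i \<notin> \<Lambda> \<longrightarrow> y i = (x(n := s)) i" ..
  qed auto
  then show "y \<in> cyl (- insert n \<Lambda>) x \<longleftrightarrow> y \<in> (\<Union>s. cyl (- \<Lambda>) (x(n := s)))"
    by (simp only: UN_iff mem_cyl_Compl UNIV_I bex_UNIV)
qed

lemma finite_cyl [simp]: "finite \<Lambda> \<Longrightarrow> finite (cyl (- \<Lambda>) (x :: 's::finite config))"
proof (induction \<Lambda> arbitrary: x rule: finite_induct)
  case (insert n \<Lambda>)
  show ?case unfolding cyl_Compl_insert[OF insert.hyps(2)]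
    by (intro finite_UN_I insert.IH) simp
qed simp

lemma sum_cyl_insert:
  assumes "finite \<Lambda>" "n \<notin> \<Lambda>"
  shows "(\<Sum>y\<in>cyl (- insert n \<Lambda>) (x :: 's::finite config). h y) =
    (\<Sum>s\<in>UNIV. \<Sum>y\<in>cyl (- \<Lambda>) (x(n := s)). h y)"
  unfolding cyl_Compl_insert[OF assms(2)]
proof (rule sum.UNION_disjoint)
  show "\<forall>i\<in>UNIV. \<forall>j\<in>UNIV. i \<noteq> j \<longrightarrow> cyl (- \<Lambda>) (x(n := i)) \<inter> cyl (- \<Lambda>) (x(n := j)) = {}"
  proof (intro ballI impI equals0I)
    fix i j y assume "i \<noteq> j" "y \<in> cyl (- \<Lambda>) (x(n := i)) \<inter> cyl (- \<Lambda>) (x(n := j))"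
    then have "y n = (x(n := i)) n" "y n = (x(n := j)) n"
      using assms(2) unfolding Int_iff mem_cyl_Compl by blast+
    then show False using \<open>i \<noteq> j\<close> by simp
  qed
qed (use assms in auto)

lemma sum_cyl_singleton:
  "(\<Sum>y\<in>cyl (- {n}) (x :: 's::finite config). h y) = (\<Sum>s\<in>UNIV. h (x(n := s)))"
  using sum_cyl_insert[of "{}" n h x] by simp

lemma coord_algebra_sets: "sets (coord_algebra A) = sigma_sets UNIV {{x. x i = s} | i s. i \<in> A}"
  and coord_algebra_space [simp]: "space (coord_algebra A) = UNIV"
  by (simp_all add: coord_algebra_def)

text \<open>The sets that do not separate \<open>x\<close> from \<open>y\<close> form a
  sigma-algebra containing the generators.\<close>

lemma coord_algebra_sets_agree:
  assumes "B \<in> sets (coord_algebra A)" "agree A x y"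
  shows "x \<in> B \<longleftrightarrow> y \<in> B"
  using assms(1) unfolding coord_algebra_sets
proof (induction rule: sigma_sets.induct)
  case (Basic a)
  then obtain i s where "a = {x. x i = s}" "i \<in> A" by blast
  then show ?case using agreeD[OF assms(2)] by simp
qed auto

lemma coord_algebra_measurable_agree:
  fixes h :: "'s config \<Rightarrow> real"
  assumes "h \<in> borel_measurable (coord_algebra A)" "agree A x y"
  shows "h x = h y"
proof -
  have "h -` {h x} \<inter> space (coord_algebra A) \<in> sets (coord_algebra A)"
    by (rule measurable_sets[OF assms(1)]) simp
  then show ?thesis using coord_algebra_sets_agree[OF _ assms(2)] by fastforce
qed

text \<open>\<open>f n\<close> does not see the sites in \<open>[0, n)\<close>, so it can be taken
  out of the inner sum over these sites.\<close>

lemma partition_sum_eq_sum_cyl: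
  assumes "\<And>j x y. agree (- {0..<int j}) x y \<Longrightarrow> f j x = f j y"
  shows "partition_sum f h n x = (\<Sum>y\<in>cyl (- {0..<int n}) x. (\<Prod>j<n. f j y) * h y)"
proof (induction n arbitrary: x)
  case 0
  show ?case by simp
next
  case (Suc n)
  have eq: "{0..<int (Suc n)} = insert (int n) {0..<int n}" by auto
  have "(\<Sum>y\<in>cyl (- {0..<int (Suc n)}) x. (\<Prod>j<Suc n. f j y) * h y) =
     (\<Sum>s\<in>UNIV. \<Sum>y\<in>cyl (- {0..<int n}) (x(int n := s)). (\<Prod>j<Suc n. f j y) * h y)"
    unfolding eq by (rule sum_cyl_insert) auto
  also have "\<dots> = (\<Sum>s\<in>UNIV. f n (x(int n := s)) *
      (\<Sum>y\<in>cyl (- {0..<int n}) (x(int n := s)). (\<Prod>j<n. f j y) * h y))"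
    unfolding sum_distrib_left
  proof (intro sum.cong refl)
    fix s y assume "y \<in> cyl (- {0..<int n}) (x(int n := s))"
    then have "f n y = f n (x(int n := s))" by (intro assms) (simp add: cyl_def)
    then show "(\<Prod>j<Suc n. f j y) * h y = f n (x(int n := s)) * ((\<Prod>j<n. f j y) * h y)"
      by simp
  qed
  finally show ?case unfolding partition_sum.simps Suc.IH by (rule sym)
qed

section \<open>Specifications with a specification sequence\<close>

locale sequenced_spec =
  fixes \<phi> :: "int set \<Rightarrow> 's::{finite,discrete_topology} config \<Rightarrow> real"
    and f :: "nat \<Rightarrow> 's config \<Rightarrow> real"
  assumes spec: "is_specification \<phi>"
    and cont: "continuous_spec \<phi>"
    and invar: "shift_invariant_spec \<phi>"
    and seq: "spec_sequence_for \<phi> f"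
begin

lemma f_pos: "0 < f n x"
  using seq by (simp add: spec_sequence_for_def spec_sequence_def)

lemma f_agree: "agree (- {0..<int j}) x y \<Longrightarrow> f j x = f j y"
  using seq coord_algebra_measurable_agree[of "f j" "- {0..<int j}"]
  by (auto simp: spec_sequence_for_def spec_sequence_def)

lemma partition_sum_spec: "partition_sum f h n x = (\<Sum>y\<in>cyl (- {0..<int n}) x. (\<Prod>j<n. f j y) * h y)"
  by (rule partition_sum_eq_sum_cyl) (rule f_agree)

definition at0 :: "'s \<Rightarrow> 's config \<Rightarrow> real" where
  "at0 a y = of_bool (y 0 = a)"

lemma site_observable_at0: "site_observable (at0 a)"
  unfolding site_observable_def at0_def by (auto intro: exI[of _ "\<lambda>_. a"])

lemma site_observable_1: "site_observable (\<lambda>_. 1)"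
  by (simp add: site_observable_def)

text \<open>The normalising sum in \<open>\<phi>\<close> is the same at all points of the cylinder,
  so it becomes a common denominator.\<close>

lemma g_approx_eq: "g_approx \<phi> n x = partition_sum f (at0 (x 0)) (Suc n) x / partition_sum f (\<lambda>_. 1) (Suc n) x"
proof -
  have eq: "{0..int n} = {0..<int (Suc n)}" by auto
  have "\<phi> {0..int n} y * indicator (cyl {0} x) y =
      (\<Prod>j<Suc n. f j y) * at0 (x 0) y / partition_sum f (\<lambda>_. 1) (Suc n) x"
    if "y \<in> cyl (- {0..int n}) x" for y
  proof -
    have "\<phi> {0..int n} y =
        (\<Prod>j\<le>n. f j y) * inverse (\<Sum>y\<in>cyl (- {0..int n}) y. \<Prod>j\<le>n. f j y)"
      using seq by (simp add: spec_sequence_for_def)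
    also have "(\<Sum>y\<in>cyl (- {0..int n}) y. \<Prod>j\<le>n. f j y) = partition_sum f (\<lambda>_. 1) (Suc n) x"
      unfolding partition_sum_spec eq[symmetric] cyl_eqI[OF that]
      by (simp only: lessThan_Suc_atMost mult_1_right)
    finally show ?thesis
      unfolding lessThan_Suc_atMost
      by (simp add: at0_def indicator_def cyl_def agree_def divide_inverse)
  qed
  then have "g_approx \<phi> n x =
      (\<Sum>y\<in>cyl (- {0..int n}) x. (\<Prod>j<Suc n. f j y) * at0 (x 0) y / partition_sum f (\<lambda>_. 1) (Suc n) x)"
    unfolding g_approx_def spec_kernel_def by (intro sum.cong refl)
  also have "\<dots> = partition_sum f (at0 (x 0)) (Suc n) x / partition_sum f (\<lambda>_. 1) (Suc n) x"
    unfolding partition_sum_spec eq[symmetric] sum_divide_distrib ..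
  finally show ?thesis .
qed

lemma rinf_le_1: "rinf \<Lambda> (f i) \<le> 1"
  unfolding rinf_def using f_pos[of i]
  by (intro Inf_lower CollectI exI[of _ undefined]) (auto simp: less_imp_neq[symmetric])

lemma rinf_mono: "\<Lambda> \<subseteq> \<Lambda>' \<Longrightarrow> rinf \<Lambda> (f i) \<le> rinf \<Lambda>' (f i)"
  unfolding rinf_def by (intro Inf_superset_mono) (auto intro: agree_mono)

text \<open>One formula for both series of the theorem: if \<open>P\<close> is the set of negative
  integers, the window is \<open>{..i + j}\<close>, and if \<open>P\<close> is
  \<open>{- int n..<0}\<close>, it is \<open>{- int n..i + j}\<close>.\<close>

definition inf_variation :: "int set \<Rightarrow> nat \<Rightarrow> ennreal" where
  "inf_variation P j = (INF i. rinf (P \<union> {0..int i + int j}) (f i))"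

lemma inf_variation_le_1: "inf_variation P j \<le> 1"
  unfolding inf_variation_def by (rule INF_lower2[of 0]) (simp_all add: rinf_le_1)

lemma inf_variation_mono: "i \<le> j \<Longrightarrow> inf_variation P i \<le> inf_variation P j"
  unfolding inf_variation_def by (intro INF_mono' rinf_mono) auto

lemma inf_variation_finite: "inf_variation P j = ennreal (enn2real (inf_variation P j))"
  using inf_variation_le_1[of P j] by (simp add: le_less_trans[OF _ ennreal_one_less_top])

lemma weights:
  assumes P: "P \<subseteq> {..<0}" and pos: "0 < inf_variation P 0"
  shows "weights P f (\<lambda>j. enn2real (inf_variation P j))"
proof
  fix j
  have fin: "inf_variation P j < top" using inf_variation_le_1[of P j] by (rule le_less_trans) simp
  show "0 < enn2real (inf_variation P j)"
    using less_le_trans[OF pos inf_variation_mono[of 0 j]] fin by (simp add: enn2real_positive_iff)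
  show "enn2real (inf_variation P j) \<le> 1"
    using enn2real_mono[OF inf_variation_le_1[of P j]] by simp
next
  fix i j and x y :: "'s config"
  assume ag: "agree (P \<union> {int i..int i + int j}) x y"
  \<comment> \<open>The arguments may differ on \<open>[0, i)\<close>. Copying \<open>y\<close>
    there does not affect \<open>f i\<close> and gives agreement with \<open>y\<close> on the whole
    window from \<open>0\<close> to \<open>i + j\<close>.\<close>
  define z where "z = (\<lambda>k. if k \<in> {0..<int i} then y k else x k)"
  have zx: "f i z = f i x" by (rule f_agree, rule agreeI) (auto simp: z_def)
  have zy: "agree (P \<union> {0..int i + int j}) y z"
  proof (rule agreeI)
    fix k assume "k \<in> P \<union> {0..int i + int j}"
    then show "y k = z k" using P agreeD[OF ag, of k] by (auto simp: z_def)
  qed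
  have "inf_variation P j \<le> rinf (P \<union> {0..int i + int j}) (f i)"
    unfolding inf_variation_def by (rule INF_lower) simp
  also have "\<dots> \<le> ennreal (f i y / f i z)"
    unfolding rinf_def using zy by (intro Inf_lower) blast
  finally have "enn2real (inf_variation P j) \<le> f i y / f i x"
    unfolding zx using f_pos[of i x] f_pos[of i y]
    by (metis divide_pos_pos enn2real_ennreal enn2real_mono ennreal_less_top less_imp_le)
  then show "enn2real (inf_variation P j) * f i x \<le> f i y"
    using f_pos[of i x] by (simp add: pos_le_divide_eq)
qed (use P f_pos in auto)

end

lemma continuous_on_upd: "continuous_on UNIV (\<lambda>x :: 's::topological_space config. x(i := s))"
proof (rule continuous_on_coordinatewise_then_product)
  fix j show "continuous_on UNIV (\<lambda>x :: 's config. (x(i := s)) j)"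
    by (cases "j = i") simp_all
qed

text \<open>Site by site, the sum over a cylinder that moves with \<open>x\<close> becomes a finite
  sum of \<open>h\<close> composed with continuous updates.\<close>

lemma continuous_on_sum_cyl:
  fixes h :: "'s::{finite,discrete_topology} config \<Rightarrow> real"
  assumes "finite \<Lambda>" "continuous_on UNIV h"
  shows "continuous_on UNIV (\<lambda>x. \<Sum>y\<in>cyl (- \<Lambda>) x. h y)"
  using assms(1)
proof (induction \<Lambda> rule: finite_induct)
  case (insert n \<Lambda>)
  show ?case unfolding sum_cyl_insert[OF insert.hyps]
    by (intro continuous_on_sum continuous_on_compose2[OF insert.IH continuous_on_upd]) simp
qed (simp add: assms(2))

context sequenced_spec
begin

lemma continuous_on_at0: "continuous_on UNIV (at0 a)"
proof -
  have "continuous_on UNIV (\<lambda>s :: 's. of_bool (s = a) :: real)" by (rule Topological_Spaces.continuous_on_discrete)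
  from continuous_on_compose2[OF this continuous_on_product_coordinates[of 0]]
  show ?thesis by (simp add: at0_def)
qed

lemma phi_nonneg: "\<Lambda> \<in> finite_nonempty \<Longrightarrow> 0 \<le> \<phi> \<Lambda> x"
  using spec by (simp add: is_specification_def)

lemma phi_sum: "\<Lambda> \<in> finite_nonempty \<Longrightarrow> (\<Sum>y\<in>cyl (- \<Lambda>) x. \<phi> \<Lambda> y) = 1"
  using spec by (simp add: is_specification_def)

lemma phi_cont: "\<Lambda> \<in> finite_nonempty \<Longrightarrow> continuous_on UNIV (\<phi> \<Lambda>)"
  using cont by (simp add: continuous_spec_def)

lemma initial_interval_finite_nonempty [simp]: "{0..int n} \<in> finite_nonempty"
  by (simp add: finite_nonempty_def)

lemma g_approx_at0: "g_approx \<phi> n x = (\<Sum>y\<in>cyl (- {0..int n}) x. \<phi> {0..int n} y * at0 (x 0) y)"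
  by (simp add: g_approx_def spec_kernel_def at0_def indicator_def cyl_def agree_def)

lemma g_approx_nonneg: "0 \<le> g_approx \<phi> n x"
  unfolding g_approx_at0 by (intro sum_nonneg mult_nonneg_nonneg phi_nonneg) (simp_all add: at0_def)

lemma g_approx_pos: "0 < g_approx \<phi> n x"
  unfolding g_approx_eq by (intro divide_pos_pos partition_sum_pos f_pos site_observable_at0 site_observable_1)

lemma g_approx_sum: "(\<Sum>s\<in>UNIV. g_approx \<phi> n (x(0 := s))) = 1"
proof -
  have "cyl (- {0..int n}) (x(0 := s)) = cyl (- {0..int n}) x" for s
    by (rule cyl_cong, rule agreeI) auto
  then have "(\<Sum>s\<in>UNIV. g_approx \<phi> n (x(0 := s))) =
      (\<Sum>y\<in>cyl (- {0..int n}) x. \<Sum>s\<in>UNIV. \<phi> {0..int n} y * at0 s y)"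
    unfolding g_approx_at0 by (subst sum.swap) simp
  also have "\<dots> = (\<Sum>y\<in>cyl (- {0..int n}) x. \<phi> {0..int n} y)"
    by (intro sum.cong refl) (simp add: at0_def of_bool_def if_distrib cong: if_cong)
  finally show ?thesis by (simp add: phi_sum)
qed

lemma g_approx_le_1: "g_approx \<phi> n x \<le> 1"
proof -
  have "g_approx \<phi> n (x(0 := x 0)) \<le> (\<Sum>s\<in>UNIV. g_approx \<phi> n (x(0 := s)))"
    by (rule member_le_sum) (auto intro: g_approx_nonneg)
  then show ?thesis unfolding g_approx_sum by simp
qed

lemma g_approx_cont: "continuous_on UNIV (g_approx \<phi> n)"
proof -
  \<comment> \<open>The observable varies with \<open>x\<close> through \<open>x 0\<close>;
    splitting by this symbol leaves a fixed observable in each summand.\<close>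
  have "g_approx \<phi> n = (\<lambda>x. \<Sum>a\<in>UNIV. at0 a x *
      (\<Sum>y\<in>cyl (- {0..int n}) x. \<phi> {0..int n} y * at0 a y))"
  proof
    fix x
    have "(\<Sum>a\<in>UNIV. at0 a x * S a) = (\<Sum>a\<in>UNIV. if x 0 = a then S a else 0)" for S :: "'s \<Rightarrow> real"
      by (rule sum.cong) (simp_all add: at0_def)
    then show "g_approx \<phi> n x = (\<Sum>a\<in>UNIV. at0 a x *
        (\<Sum>y\<in>cyl (- {0..int n}) x. \<phi> {0..int n} y * at0 a y))"
      by (simp add: g_approx_at0)
  qed
  then show ?thesis
    by (simp only:) (intro continuous_on_sum continuous_on_mult continuous_on_at0 continuous_on_sum_cyl phi_cont;
      simp)
qed

definition partial_R :: "int set \<Rightarrow> nat \<Rightarrow> real" where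
  "partial_R P n = (\<Sum>k<Suc n. \<Prod>j\<le>k. enn2real (inf_variation P j))"

text \<open>The constant of the cross-ratio bound after \<open>n + 1\<close> sites; for positive
  \<open>partial_R P n\<close> its inverse is the square of
  \<open>1 + inverse (partial_R P n)\<close>.\<close>

definition \<theta> :: "int set \<Rightarrow> nat \<Rightarrow> real" where
  "\<theta> P n = (partial_R P n / (1 + partial_R P n))\<^sup>2"

text \<open>With \<open>y\<close> fixed, the cross-ratio bound is a linear inequality between
  \<open>F\<close> and \<open>G\<close> at all points sharing \<open>P\<close> with
  \<open>y\<close>. It therefore persists when the sites up to \<open>m\<close> are summed as well.
  The second estimate comes from exchanging \<open>F\<close> and \<open>G\<close>.\<close>

lemma g_approx_ratio:
  assumes P: "P \<subseteq> {..<0}" and pos: "0 < inf_variation P 0" and ag: "agree (P \<union> {0}) y x" and n: "n \<le> m"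
  shows "\<theta> P n * g_approx \<phi> n y \<le> g_approx \<phi> m x" "\<theta> P n * g_approx \<phi> m x \<le> g_approx \<phi> n y"
proof -
  interpret w: weights P f "\<lambda>j. enn2real (inf_variation P j)" by (rule weights[OF P pos])
  \<comment> \<open>The index shifts by one: \<open>w.R\<close> sums \<open>u K\<close> from
    \<open>K = 1\<close>, the series starts with the product that consists of the factor
    \<open>j = 0\<close>.\<close>
  have R: "w.R (Suc n) = partial_R P n"
    unfolding w.R_def partial_R_def w.u_def One_nat_def sum.atLeast1_atMost_eq lessThan_Suc_atMost ..
  have x0: "x 0 = y 0" using agreeD[OF ag, of 0] by simp
  have agP: "agree P y x" by (rule agree_mono[OF ag]) auto
  define F where "F = partition_sum f (at0 (y 0))"
  define G where "G = partition_sum f (\<lambda>_ :: 's config. 1)"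
  have Fp: "0 < F (Suc n) z" and Gp: "0 < G (Suc n) z" for n z
    unfolding F_def G_def by (intro partition_sum_pos f_pos site_observable_at0 site_observable_1)+
  have gy: "g_approx \<phi> k y = F (Suc k) y / G (Suc k) y"
    and gx: "g_approx \<phi> k x = F (Suc k) x / G (Suc k) x" for k
    by (simp_all only: g_approx_eq F_def G_def x0)
  have 1: "\<theta> P n * (F (Suc n) y / G (Suc n) y) * G (Suc n) z \<le> F (Suc n) z" if "agree P y z" for z
    using w.cross_ratio[OF site_observable_at0[of "y 0"] site_observable_1, of "Suc n" y z y] that Gp[of n y]
    by (simp add: R \<theta>_def F_def G_def divide_le_eq mult_ac)
  have "\<theta> P n * (F (Suc n) y / G (Suc n) y) * G (Suc m) x \<le> F (Suc m) x"
    using w.bound_propagates[OF 1[unfolded F_def G_def] _ agP, of "Suc m"] n by (simp add: F_def G_def)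
  then show "\<theta> P n * g_approx \<phi> n y \<le> g_approx \<phi> m x"
    unfolding gx gy using Gp[of m x] by (simp add: pos_le_divide_eq)
  have 2: "\<theta> P n * (G (Suc n) y / F (Suc n) y) * F (Suc n) z \<le> G (Suc n) z" if "agree P y z" for z
    using w.cross_ratio[OF site_observable_1 site_observable_at0[of "y 0"], of "Suc n" y z y] that Fp[of n y]
    by (simp add: R \<theta>_def F_def G_def divide_le_eq mult_ac)
  have "\<theta> P n * (G (Suc n) y / F (Suc n) y) * F (Suc m) x \<le> G (Suc m) x"
    using w.bound_propagates[OF 2[unfolded F_def G_def] _ agP, of "Suc m"] n by (simp add: F_def G_def)
  then have "\<theta> P n * F (Suc m) x * G (Suc n) y \<le> G (Suc m) x * F (Suc n) y"
    using Fp[of n y] by (simp add: divide_le_eq mult_ac)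
  then show "\<theta> P n * g_approx \<phi> m x \<le> g_approx \<phi> n y"
    unfolding gx gy using Gp[of m x] Gp[of n y] by (simp add: field_simps)
qed

lemma partial_R_pos: "0 < inf_variation P 0 \<Longrightarrow> 0 < partial_R P n"
  and partial_R_nonneg: "0 \<le> partial_R P n"
proof -
  show "0 \<le> partial_R P n" unfolding partial_R_def by (intro sum_nonneg prod_nonneg) simp
  assume c: "0 < inf_variation P 0"
  have "0 < enn2real (inf_variation P 0)"
    using c le_less_trans[OF inf_variation_le_1[of P 0]] by (simp add: enn2real_positive_iff)
  then show "0 < partial_R P n"
    unfolding partial_R_def by (intro sum_pos2[of _ 0]) (auto intro!: prod_nonneg)
qed

lemma partial_R_tendsto: "(\<lambda>n. ennreal (partial_R P n)) \<longlonglongrightarrow> (\<Sum>k. \<Prod>j\<le>k. inf_variation P j)"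
proof -
  have "ennreal (partial_R P n) = (\<Sum>k<Suc n. \<Prod>j\<le>k. inf_variation P j)" for n
  proof -
    have "(\<Prod>j\<le>k. inf_variation P j) = ennreal (\<Prod>j\<le>k. enn2real (inf_variation P j))" for k
      by (subst inf_variation_finite) (simp add: prod_ennreal)
    then show ?thesis unfolding partial_R_def by (simp add: sum_ennreal prod_nonneg del: sum.lessThan_Suc)
  qed
  then show ?thesis using LIMSEQ_Suc[OF summable_LIMSEQ[of "\<lambda>k. \<Prod>j\<le>k. inf_variation P j"]] by simp
qed

end

section \<open>The limit function of a divergent series\<close>

locale divergent_spec = sequenced_spec \<phi> f
  for \<phi> :: "int set \<Rightarrow> 's::{finite,discrete_topology} config \<Rightarrow> real" and f +
  assumes div: "(\<Sum>k. \<Prod>j\<le>k. inf_variation {..<0} j) = \<infinity>"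
begin

text \<open>The factor \<open>j = 0\<close> occurs in every product, so its vanishing would make the
  series zero.\<close>

lemma inf_variation_0_pos: "0 < inf_variation {..<0} 0"
proof (rule ccontr)
  assume "\<not> 0 < inf_variation {..<0} 0"
  then have zero: "(\<Prod>j\<le>k. inf_variation {..<0} j) = 0" for k :: nat
    by (intro prod_zero bexI[of _ 0]) simp_all
  show False using div unfolding zero by simp
qed

lemma partial_R_at_top: "LIM n sequentially. partial_R {..<0} n :> at_top"
  using partial_R_tendsto[of "{..<0}"] unfolding div by (simp add: ennreal_tendsto_top_eq_at_top)

lemma \<theta>_tendsto: "\<theta> {..<0} \<longlonglongrightarrow> 1"
proof -
  have "(\<lambda>n. 1 - inverse (1 + partial_R {..<0} n)) \<longlonglongrightarrow> 1 - 0"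
    by (intro tendsto_diff tendsto_const tendsto_inverse_0_at_top
        filterlim_tendsto_add_at_top[OF tendsto_const] partial_R_at_top)
  then have "(\<lambda>n. (1 - inverse (1 + partial_R {..<0} n))\<^sup>2) \<longlonglongrightarrow> (1 - 0)\<^sup>2"
    by (rule tendsto_power)
  moreover have "1 - inverse (1 + partial_R {..<0} n) = partial_R {..<0} n / (1 + partial_R {..<0} n)" for n
    using partial_R_nonneg[of "{..<0}" n] by (simp add: field_simps)
  ultimately show ?thesis by (simp add: \<theta>_def[abs_def])
qed

text \<open>For numbers in \<open>[0, 1]\<close> the two ratio bounds turn into a bound on the
  difference. Varying level and future at once serves both the Cauchy property and the independence
  of the limit from positive coordinates.\<close>

lemma g_approx_close:
  assumes "agree {..0} y x" "n \<le> m"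
  shows "\<bar>g_approx \<phi> n y - g_approx \<phi> m x\<bar> \<le> 1 - \<theta> {..<0} n"
proof -
  have "{..<0} \<union> {0} = {..0::int}" by auto
  then have ag: "agree ({..<0} \<union> {0}) y x" using assms(1) by simp
  have th: "0 \<le> \<theta> {..<0} n" "\<theta> {..<0} n \<le> 1"
    using partial_R_nonneg[of "{..<0}" n] by (auto simp: \<theta>_def power_le_one)
  have le: "(1 - \<theta> {..<0} n) * t \<le> 1 - \<theta> {..<0} n" if "t \<le> 1" for t
    using th that by (simp add: mult_left_le)
  show ?thesis
    using g_approx_ratio[OF _ inf_variation_0_pos ag assms(2)] le[OF g_approx_le_1[of n y]] le[OF g_approx_le_1[of m x]]
    by (auto simp: algebra_simps abs_le_iff)
qed

abbreviation "g \<equiv> g_of_spec \<phi>"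

lemma g_uniform: "uniform_limit UNIV (g_approx \<phi>) g sequentially"
proof -
  have "uniformly_Cauchy_on UNIV (g_approx \<phi>)"
  proof (rule uniformly_Cauchy_onI')
    fix e :: real assume "0 < e"
    have "eventually (\<lambda>n. 1 - e < \<theta> {..<0} n) sequentially"
      using \<open>0 < e\<close> by (intro order_tendstoD[OF \<theta>_tendsto]) simp
    then obtain M where M: "\<And>n. M \<le> n \<Longrightarrow> 1 - e < \<theta> {..<0} n"
      by (auto simp: eventually_sequentially)
    show "\<exists>M. \<forall>x\<in>UNIV. \<forall>m\<ge>M. \<forall>n>m. dist (g_approx \<phi> m x) (g_approx \<phi> n x) < e"
    proof (intro exI[of _ M] ballI allI impI)
      fix x m n assume "M \<le> m" "m < n"
      then show "dist (g_approx \<phi> m x) (g_approx \<phi> n x) < e"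
        using M[of m] g_approx_close[OF agree_refl, of m n x] by (simp add: dist_real_def)
    qed
  qed
  then have "uniformly_convergent_on UNIV (g_approx \<phi>)" by (rule Cauchy_uniformly_convergent)
  then show ?thesis
    unfolding uniformly_convergent_uniform_limit_iff by (simp add: g_of_spec_def[abs_def])
qed

lemma g_tendsto: "(\<lambda>n. g_approx \<phi> n x) \<longlonglongrightarrow> g x"
  by (rule tendsto_uniform_limitI[OF g_uniform]) simp

lemma g_cont: "continuous_on UNIV g"
  by (rule uniform_limit_theorem[OF _ g_uniform]) (simp_all add: g_approx_cont)

text \<open>Already level \<open>0\<close> bounds all later approximations from below, up to the
  positive factor \<open>\<theta> {..<0} 0\<close>.\<close>

lemma g_pos: "0 < g x"
proof -
  have ag: "agree ({..<0} \<union> {0}) x x" by simp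
  have "\<theta> {..<0} 0 * g_approx \<phi> 0 x \<le> g x"
    by (rule LIMSEQ_le_const[OF g_tendsto])
      (use g_approx_ratio(1)[OF _ inf_variation_0_pos ag, of 0] in auto)
  moreover have "0 < \<theta> {..<0} 0"
    using partial_R_pos[OF inf_variation_0_pos, of 0] by (simp add: \<theta>_def)
  ultimately show ?thesis using g_approx_pos[of 0 x] by (meson less_le_trans mult_pos_pos)
qed

lemma g_le_1: "g x \<le> 1"
  by (rule LIMSEQ_le_const2[OF g_tendsto]) (auto intro: g_approx_le_1)

lemma g_sum: "(\<Sum>s\<in>UNIV. g (x(0 := s))) = 1"
proof -
  have "(\<lambda>n. \<Sum>s\<in>UNIV. g_approx \<phi> n (x(0 := s))) \<longlonglongrightarrow> (\<Sum>s\<in>UNIV. g (x(0 := s)))"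
    by (intro tendsto_sum g_tendsto)
  then show ?thesis unfolding g_approx_sum by (simp add: LIMSEQ_const_iff)
qed

lemma g_agree:
  assumes "agree {..0} x y"
  shows "g x = g y"
proof -
  have "(\<lambda>n. 1 - \<theta> {..<0} n) \<longlonglongrightarrow> 1 - 1" by (intro tendsto_intros \<theta>_tendsto)
  then have lim: "(\<lambda>n. 1 - \<theta> {..<0} n) \<longlonglongrightarrow> 0" by simp
  have "(\<lambda>n. g_approx \<phi> n x - g_approx \<phi> n y) \<longlonglongrightarrow> 0"
    by (rule Lim_null_comparison[OF _ lim]) (use g_approx_close[OF assms] in auto)
  moreover have "(\<lambda>n. g_approx \<phi> n x - g_approx \<phi> n y) \<longlonglongrightarrow> g x - g y"
    by (intro tendsto_diff g_tendsto)
  ultimately show ?thesis using LIMSEQ_unique by fastforce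
qed

lemma inf_variation_interval: "inf_variation {- int N..<0} j = (INF i. rinf {- int N..int i + int j} (f i))"
proof -
  have "{- int N..<0} \<union> {0..int i + int j} = {- int N..int i + int j}" for i by auto
  then show ?thesis by (simp add: inf_variation_def)
qed

lemma g_rsup: "rsup {- int N..0} g \<le> (1 + inverse (R_sum f N))\<^sup>2"
proof (cases "0 < inf_variation {- int N..<0} 0")
  \<comment> \<open>Then \<open>R_sum f N = 0\<close>, its inverse is infinite and the bound is
    trivial.\<close>
  case False
  then have zero: "(\<Prod>j\<le>k. inf_variation {- int N..<0} j) = 0" for k :: nat
    by (intro prod_zero bexI[of _ 0]) simp_all
  have "R_sum f N = 0" unfolding R_sum_def inf_variation_interval[symmetric] zero by simp
  then show ?thesis by (simp add: power2_eq_square)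
next
  case True
  define P where "P = {- int N..<0}"
  have c: "0 < inf_variation P 0" using True by (simp add: P_def)
  have un: "P \<union> {0} = {- int N..0}" by (auto simp: P_def)
  have lim: "(\<lambda>n. ennreal (partial_R P n)) \<longlonglongrightarrow> R_sum f N"
    using partial_R_tendsto[of P] by (simp add: R_sum_def inf_variation_interval P_def)
  have "(\<lambda>n. inverse (ennreal (partial_R P n))) \<longlonglongrightarrow> inverse (R_sum f N)"
    using continuous_on_inverse_ennreal[OF continuous_on_id, of UNIV]
    by (intro continuous_on_tendsto_compose[OF _ lim, of UNIV]) auto
  then have lim1: "(\<lambda>n. 1 + inverse (ennreal (partial_R P n))) \<longlonglongrightarrow> 1 + inverse (R_sum f N)"
    by (intro tendsto_add tendsto_const)
  \<comment> \<open>The limit may be infinite; multiplication in \<open>ennreal\<close> is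
    continuous here because the factors are never \<open>0\<close>.\<close>
  have lim2: "(\<lambda>n. (1 + inverse (ennreal (partial_R P n)))\<^sup>2) \<longlonglongrightarrow> (1 + inverse (R_sum f N))\<^sup>2"
    unfolding power2_eq_square by (intro tendsto_mult_ennreal lim1) (auto simp: add_eq_0_iff_both_eq_0)
  show ?thesis
    unfolding rsup_def
  proof (rule Sup_least, safe)
    fix x y :: "'s config" assume "agree {- int N..0} x y"
    then have ag: "agree (P \<union> {0}) x y" by (simp only: un)
    \<comment> \<open>Both points are taken at the same level and share only the finite past
      \<open>P\<close> and the symbol at \<open>0\<close>; the constant is
      \<open>1 / \<theta> P n\<close>.\<close>
    have "ennreal (g_approx \<phi> n x / g_approx \<phi> n y) \<le> (1 + inverse (ennreal (partial_R P n)))\<^sup>2" for n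
    proof -
      have R: "0 < partial_R P n" by (rule partial_R_pos[OF c])
      then have th: "0 < \<theta> P n" by (simp add: \<theta>_def)
      have "\<theta> P n * g_approx \<phi> n x \<le> g_approx \<phi> n y"
        by (rule g_approx_ratio(1)[OF _ c ag]) (auto simp: P_def)
      then have "g_approx \<phi> n x / g_approx \<phi> n y \<le> 1 / \<theta> P n"
        using g_approx_pos[of n y] th by (simp add: divide_le_eq le_divide_eq mult.commute)
      also have "\<dots> = (1 + inverse (partial_R P n))\<^sup>2"
      proof -
        have "(1 + partial_R P n) / partial_R P n = 1 + inverse (partial_R P n)"
          using R by (simp add: add_divide_distrib inverse_eq_divide)
        moreover have "1 / \<theta> P n = ((1 + partial_R P n) / partial_R P n)\<^sup>2"
          by (simp add: \<theta>_def power_divide)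
        ultimately show ?thesis by (simp only:)
      qed
      finally have "ennreal (g_approx \<phi> n x / g_approx \<phi> n y) \<le> ennreal ((1 + inverse (partial_R P n))\<^sup>2)"
        by (rule ennreal_leI)
      also have "\<dots> = (1 + inverse (ennreal (partial_R P n)))\<^sup>2"
      proof -
        have "1 + inverse (ennreal (partial_R P n)) = ennreal (1 + inverse (partial_R P n))"
          using R by (simp add: inverse_ennreal)
        then show ?thesis using R by (simp only:) (rule ennreal_power[symmetric], simp)
      qed
      finally show ?thesis .
    qed
    moreover have "(\<lambda>n. ennreal (g_approx \<phi> n x / g_approx \<phi> n y)) \<longlonglongrightarrow> ennreal (g x / g y)"
      by (intro tendsto_ennrealI tendsto_divide g_tendsto) (use g_pos[of y] in simp)
    ultimately show "ennreal (g x / g y) \<le> (1 + inverse (R_sum f N))\<^sup>2"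
      using lim2 by (intro LIMSEQ_le) auto
  qed
qed

end

section \<open>Measurability in terms of coordinates\<close>

text \<open>A cylinder is determined by its pattern on \<open>\<Lambda>\<close>, and all patterns
  occur among the configurations equal to a fixed \<open>z\<close> outside
  \<open>\<Lambda>\<close>.\<close>

lemma finite_range_cyl:
  assumes "finite \<Lambda>"
  shows "finite (range (cyl \<Lambda> :: 's::finite config \<Rightarrow> 's config set))"
proof (rule finite_subset)
  fix z :: "'s config"
  show "range (cyl \<Lambda>) \<subseteq> cyl \<Lambda> ` cyl (- \<Lambda>) z"
  proof safe
    fix x :: "'s config"
    have "cyl \<Lambda> x = cyl \<Lambda> (override_on z x \<Lambda>)"
      by (rule cyl_cong, rule agreeI) simp
    moreover have "override_on z x \<Lambda> \<in> cyl (- \<Lambda>) z" by (simp add: mem_cyl_Compl)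
    ultimately show "cyl \<Lambda> x \<in> cyl \<Lambda> ` cyl (- \<Lambda>) z" by (simp only: imageI)
  qed
qed (simp add: assms)

lemma cyl_in_coord_algebra:
  assumes "finite \<Lambda>" "\<Lambda> \<subseteq> A"
  shows "cyl \<Lambda> x \<in> sets (coord_algebra A)"
  using assms
proof (induction \<Lambda> rule: finite_induct)
  case empty
  have "cyl {} x = space (coord_algebra A)" by (auto simp: cyl_def agree_def)
  then show ?case by (simp only: sets.top)
next
  case (insert i \<Lambda>)
  have "{y. y i = x i} \<in> sets (coord_algebra A)"
    unfolding coord_algebra_sets using insert.prems by (intro sigma_sets.Basic) blast
  moreover have "cyl (insert i \<Lambda>) x = {y. y i = x i} \<inter> cyl \<Lambda> x"
    by (auto simp: cyl_def agree_def)
  ultimately show ?case using insert by auto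
qed

lemma open_contains_cyl:
  fixes U :: "'s::topological_space config set"
  assumes "open U" "x \<in> U"
  obtains n :: nat where "cyl {- int n..int n} x \<subseteq> U"
proof -
  have "openin (product_topology (\<lambda>_. euclidean) UNIV) U"
    using assms(1) by (simp add: open_fun_def)
  from product_topology_open_contains_basis[OF this assms(2)] obtain V
    where V: "x \<in> (\<Pi>\<^sub>E i\<in>UNIV. V i)" "finite {i. V i \<noteq> UNIV}" "(\<Pi>\<^sub>E i\<in>UNIV. V i) \<subseteq> U"
    by auto
  define n where "n = Max (insert 0 ((\<lambda>i. nat \<bar>i\<bar>) ` {i. V i \<noteq> UNIV}))"
  have n: "i \<in> {- int n..int n}" if "V i \<noteq> UNIV" for i
  proof -
    have "nat \<bar>i\<bar> \<le> n" unfolding n_def using that V(2) by (intro Max_ge) auto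
    then show ?thesis by auto
  qed
  have "cyl {- int n..int n} x \<subseteq> U"
  proof
    fix y assume "y \<in> cyl {- int n..int n} x"
    then have "y i \<in> V i" for i
      using n[of i] V(1) unfolding cyl_def agree_def by (cases "V i = UNIV") (auto simp: PiE_iff)
    then show "y \<in> U" using V(3) by (auto simp: PiE_iff)
  qed
  then show thesis by (rule that)
qed

lemma coord_algebra_subset_borel:
  "sets (coord_algebra A) \<subseteq> sets (borel :: 's::discrete_topology config measure)"
proof -
  have "{x :: 's config. x i = s} \<in> sets borel" for i s
  proof -
    have "open ((\<lambda>x :: 's config. x i) -` {s})"
      by (intro open_vimage Topological_Spaces.open_discrete continuous_on_product_coordinates)
    then show ?thesis by (simp add: vimage_def)
  qed
  then have "{{x :: 's config. x i = s} | i s. i \<in> A} \<subseteq> sets borel" by blast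
  from sets.sigma_sets_subset[OF this] show ?thesis by (simp add: coord_algebra_sets)
qed

text \<open>An open set is the countable union over \<open>n\<close> of the cylinders on
  \<open>[-n, n]\<close> that it contains, and for each \<open>n\<close> there are only finitely
  many of these.\<close>

lemma borel_eq_coord_algebra:
  "sets (borel :: 's::{finite,discrete_topology} config measure) = sets (coord_algebra UNIV)"
proof
  show "sets (borel :: 's config measure) \<subseteq> sets (coord_algebra UNIV)"
  proof -
    have "U \<in> sets (coord_algebra UNIV)" if "open U" for U :: "'s config set"
    proof -
      define \<U> where "\<U> n = {C \<in> range (cyl {- int n..int n}). C \<subseteq> U}" for n
      have "U = (\<Union>n. \<Union>(\<U> n))"
      proof
        show "U \<subseteq> (\<Union>n. \<Union>(\<U> n))"
        proof
          fix x assume "x \<in> U"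
          with that obtain n where "cyl {- int n..int n} x \<subseteq> U" by (rule open_contains_cyl)
          then have "cyl {- int n..int n} x \<in> \<U> n" by (simp add: \<U>_def)
          then show "x \<in> (\<Union>n. \<Union>(\<U> n))" using cyl_self by blast
        qed
      qed (auto simp: \<U>_def)
      moreover have "\<Union>(\<U> n) \<in> sets (coord_algebra UNIV)" for n
      proof (rule sets.finite_Union)
        show "finite (\<U> n)"
          unfolding \<U>_def by (rule finite_subset[OF _ finite_range_cyl]) auto
        show "\<U> n \<subseteq> sets (coord_algebra UNIV)"
          unfolding \<U>_def by (auto intro: cyl_in_coord_algebra)
      qed
      then have "(\<Union>n. \<Union>(\<U> n)) \<in> sets (coord_algebra UNIV)"
        by (intro sets.countable_nat_UN) blast
      ultimately show ?thesis by (simp only:)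
    qed
    then show ?thesis
      unfolding borel_def using sets.sigma_sets_subset[of "Collect open" "coord_algebra UNIV :: 's config measure"]
      by (simp add: sets_measure_of subset_iff)
  qed
qed (rule coord_algebra_subset_borel)

lemma measurable_into_borel:
  fixes F :: "'a \<Rightarrow> 's::{finite,discrete_topology} config"
  assumes "\<And>i s. {x \<in> space M. F x i = s} \<in> sets M"
  shows "F \<in> measurable M borel"
proof (rule measurable_sigma_sets)
  show "sets (borel :: 's config measure) = sigma_sets UNIV {{x. x i = s} | i s. i \<in> UNIV}"
    by (simp only: borel_eq_coord_algebra coord_algebra_sets)
  fix A :: "'s config set" assume "A \<in> {{x. x i = s} | i s. i \<in> UNIV}"
  then obtain i s where "A = {x. x i = s}" by blast
  then have "F -` A \<inter> space M = {x \<in> space M. F x i = s}" by auto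
  then show "F -` A \<inter> space M \<in> sets M" using assms by simp
qed auto

lemma measurable_override [measurable]:
  "(\<lambda>x. override_on x \<xi> \<Lambda>) \<in> measurable borel (borel :: 's::{finite,discrete_topology} config measure)"
proof (rule measurable_into_borel)
  fix i s
  have "{x :: 's config. x i = s} \<in> sets borel"
    using cyl_in_coord_algebra[of "{i}" UNIV "\<lambda>_. s"] coord_algebra_subset_borel[of UNIV]
    by (auto simp: cyl_def agree_def)
  then show "{x \<in> space borel. override_on x \<xi> \<Lambda> i = s} \<in> sets (borel :: 's config measure)"
    by (cases "i \<in> \<Lambda>"; cases "\<xi> i = s") auto
qed

text \<open>\<open>h\<close> factors through the map that freezes the coordinates outside
  \<open>A\<close> at an arbitrary configuration, and this map is measurable for the coordinates in
  \<open>A\<close>.\<close>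

lemma measurable_coord_algebraI:
  fixes h :: "'s::{finite,discrete_topology} config \<Rightarrow> real"
  assumes "h \<in> borel_measurable borel" "\<And>x y. agree A x y \<Longrightarrow> h x = h y"
  shows "h \<in> borel_measurable (coord_algebra A)"
proof -
  define p :: "'s config \<Rightarrow> 's config" where "p x = override_on undefined x A" for x
  have "p \<in> measurable (coord_algebra A) borel"
  proof (rule measurable_into_borel)
    fix i s
    show "{x \<in> space (coord_algebra A). p x i = s} \<in> sets (coord_algebra A)"
    proof (cases "i \<in> A")
      case True
      then have "{x \<in> space (coord_algebra A). p x i = s} = cyl {i} (\<lambda>_. s)"
        by (auto simp: p_def cyl_def agree_def)
      then show ?thesis using True by (simp add: cyl_in_coord_algebra)
    next
      case False
      then have "{x \<in> space (coord_algebra A). p x i = s} =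
          (if undefined i = s then space (coord_algebra A) else {})"
        by (auto simp: p_def)
      then show ?thesis using sets.top[of "coord_algebra A :: 's config measure"] by auto
    qed
  qed
  from measurable_compose[OF this assms(1)]
  have "(\<lambda>x. h (p x)) \<in> borel_measurable (coord_algebra A)" .
  moreover have "h (p x) = h x" for x
    by (rule assms(2), rule agreeI) (simp add: p_def)
  ultimately show ?thesis by (simp only:)
qed

lemma override_override:
  assumes "\<forall>i. i \<notin> \<Lambda> \<longrightarrow> y i = x i"
  shows "override_on x (override_on z y \<Lambda>) \<Lambda> = y"
  using assms by (auto simp: override_on_def)

text \<open>Replaces a cylinder that moves with \<open>x\<close> by a fixed finite set of patterns,
  so that the sum can be measured and integrated term by term.\<close>

lemma sum_cyl_override:
  assumes "finite \<Lambda>"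
  shows "(\<Sum>y\<in>cyl (- \<Lambda>) x. h y) = (\<Sum>\<xi>\<in>cyl (- \<Lambda>) z. h (override_on x \<xi> \<Lambda>))"
  by (rule sum.reindex_bij_witness[where i = "\<lambda>\<xi>. override_on x \<xi> \<Lambda>" and j = "\<lambda>y. override_on z y \<Lambda>"])
    (simp_all add: mem_cyl_Compl override_override)

lemma bounded_borelI:
  "h \<in> borel_measurable borel \<Longrightarrow> (\<And>x. \<bar>h x\<bar> \<le> B) \<Longrightarrow> h \<in> bounded_borel"
  unfolding bounded_borel_def by (auto simp: bounded_iff)

lemma bounded_borelE:
  assumes "h \<in> bounded_borel"
  obtains B where "h \<in> borel_measurable borel" "\<And>x. \<bar>h x\<bar> \<le> B"
  using assms unfolding bounded_borel_def bounded_iff by auto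

section \<open>Conditional probabilities and invariant kernels\<close>

lemma prob_borel_measurable:
  "prob_measure_on_X \<mu> \<Longrightarrow> h \<in> borel_measurable \<mu> \<longleftrightarrow> h \<in> borel_measurable borel"
  by (simp add: prob_measure_on_X_def cong: measurable_cong_sets)

lemma prob_integrable:
  assumes "prob_measure_on_X \<mu>" "h \<in> bounded_borel"
  shows "integrable \<mu> h"
proof -
  interpret prob_space \<mu> using assms(1) by (simp add: prob_measure_on_X_def)
  obtain B where "h \<in> borel_measurable borel" "\<And>x. \<bar>h x\<bar> \<le> B"
    using assms(2) by (rule bounded_borelE) blast
  then show ?thesis
    using assms(1) by (intro integrable_const_bound[of _ B]) (simp_all add: prob_borel_measurable)
qed

lemma bounded_borel_mult:
  assumes "h \<in> bounded_borel" "k \<in> bounded_borel"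
  shows "(\<lambda>x. h x * k x) \<in> bounded_borel"
proof -
  obtain B where B: "h \<in> borel_measurable borel" "\<And>x. \<bar>h x\<bar> \<le> B"
    using assms(1) by (rule bounded_borelE) blast
  obtain C where C: "k \<in> borel_measurable borel" "\<And>x. \<bar>k x\<bar> \<le> C"
    using assms(2) by (rule bounded_borelE) blast
  show ?thesis
  proof (rule bounded_borelI[where B = "B * C"])
    fix x
    have "0 \<le> B" using B(2)[of x] by linarith
    then show "\<bar>h x * k x\<bar> \<le> B * C"
      unfolding abs_mult using B(2)[of x] C(2)[of x] by (intro mult_mono) auto
  qed (use B C in measurable)
qed

lemma bounded_borel_override:
  fixes h :: "'s::{finite,discrete_topology} config \<Rightarrow> real"
  assumes "h \<in> bounded_borel"
  shows "(\<lambda>x. h (override_on x \<xi> \<Lambda>)) \<in> bounded_borel"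
proof -
  obtain B where B: "h \<in> borel_measurable borel" "\<And>x. \<bar>h x\<bar> \<le> B"
    using assms by (rule bounded_borelE) blast
  show ?thesis
    by (rule bounded_borelI[OF measurable_compose[OF measurable_override B(1)] B(2)])
qed

lemma bounded_borel_indicator: "A \<in> sets borel \<Longrightarrow> indicator A \<in> bounded_borel"
  by (rule bounded_borelI[where B = 1]) (auto simp: indicator_def)

lemma agree_override:
  "agree \<Delta> x y \<Longrightarrow> agree (\<Delta> \<union> \<Lambda>) (override_on x \<xi> \<Lambda>) (override_on y \<xi> \<Lambda>)"
  by (rule agreeI) (auto simp: override_on_def dest: agreeD)

text \<open>Prescribing the law of the pattern on \<open>\<Lambda>\<close> given
  \<open>\<Delta>\<close> amounts to invariance under the kernel of \<open>\<psi>\<close>, tested on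
  functions of \<open>\<Delta> \<union> \<Lambda>\<close>. Taking for \<open>\<Delta>\<close> the
  complement of \<open>\<Lambda>\<close> gives Gibbs states; a half-line followed by one site gives
  chains.\<close>

lemma cond_prob_kernel:
  fixes \<mu> :: "'s::{finite,discrete_topology} config measure"
  assumes \<mu>: "prob_measure_on_X \<mu>" and \<Lambda>: "finite \<Lambda>" "\<Lambda> \<inter> \<Delta> = {}"
    and \<psi>: "\<psi> \<in> bounded_borel" "\<And>x y. agree (\<Delta> \<union> \<Lambda>) x y \<Longrightarrow> \<psi> x = \<psi> y"
      "\<And>x. 0 \<le> \<psi> x" "\<And>x. (\<Sum>y\<in>cyl (- \<Lambda>) x. \<psi> y) = 1"
  defines "C \<equiv> AE x in \<mu>. real_cond_exp \<mu> (coord_algebra \<Delta>) (indicator (cyl \<Lambda> x)) x = \<psi> x"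
  shows "C \<Longrightarrow> h \<in> bounded_borel \<Longrightarrow> (\<And>x y. agree (\<Delta> \<union> \<Lambda>) x y \<Longrightarrow> h x = h y) \<Longrightarrow>
      (\<integral>x. spec_kernel (\<lambda>_. \<psi>) \<Lambda> h x \<partial>\<mu>) = (\<integral>x. h x \<partial>\<mu>)"
    and "(\<And>B. B \<in> sets borel \<Longrightarrow> (\<And>x y. agree (\<Delta> \<union> \<Lambda>) x y \<Longrightarrow> x \<in> B \<longleftrightarrow> y \<in> B) \<Longrightarrow>
      (\<integral>x. spec_kernel (\<lambda>_. \<psi>) \<Lambda> (indicator B) x \<partial>\<mu>) = measure \<mu> B) \<Longrightarrow> C"
proof -
  interpret prob_space \<mu> using \<mu> by (simp add: prob_measure_on_X_def)
  define F where "F = (coord_algebra \<Delta> :: 's config measure)"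
  have sets\<mu>: "sets \<mu> = sets borel" using \<mu> by (simp add: prob_measure_on_X_def)
  then have space\<mu>: "space \<mu> = UNIV" using sets_eq_imp_space_eq by fastforce
  have subalg: "subalgebra \<mu> F"
    unfolding subalgebra_def F_def using coord_algebra_subset_borel[of \<Delta>] sets\<mu> space\<mu> by auto
  interpret finite_measure_subalgebra \<mu> F
    by unfold_locales (rule subalg)
  define z :: "'s config" where "z = undefined"
  define \<Xi> where "\<Xi> = cyl (- \<Lambda>) z"
  have fin: "finite \<Xi>" unfolding \<Xi>_def using \<Lambda> by simp
  define e where "e \<xi> = real_cond_exp \<mu> F (indicator (cyl \<Lambda> \<xi>))" for \<xi>
  define p where "p \<xi> x = \<psi> (override_on x \<xi> \<Lambda>)" for \<xi> x
  \<comment> \<open>Patterns on \<open>\<Lambda>\<close> are encoded by the elements of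
    \<open>\<Xi>\<close>; \<open>rep x\<close> is the only one whose cylinder contains
    \<open>x\<close>.\<close>
  define rep where "rep x = override_on z x \<Lambda>" for x
  have rep: "rep x \<in> \<Xi>" "cyl \<Lambda> (rep x) = cyl \<Lambda> x" "override_on x (rep x) \<Lambda> = x" for x
  proof -
    show "rep x \<in> \<Xi>" by (simp add: rep_def \<Xi>_def mem_cyl_Compl)
    show "cyl \<Lambda> (rep x) = cyl \<Lambda> x" by (rule cyl_cong, rule agreeI) (simp add: rep_def)
    show "override_on x (rep x) \<Lambda> = x" unfolding rep_def by (rule override_override) simp
  qed
  have uniq: "\<xi> = rep x" if "\<xi> \<in> \<Xi>" "x \<in> cyl \<Lambda> \<xi>" for \<xi> x
  proof
    fix i
    show "\<xi> i = rep x i"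
      using that agreeD[of \<Lambda> x \<xi> i] agreeD[of "- \<Lambda>" \<xi> z i]
      by (cases "i \<in> \<Lambda>") (simp_all add: \<Xi>_def rep_def cyl_def)
  qed
  have cylb: "cyl \<Lambda> \<xi> \<in> sets borel" for \<xi> :: "'s config"
    using cyl_in_coord_algebra[OF \<Lambda>(1), of UNIV] coord_algebra_subset_borel by blast
  have indb: "indicator (cyl \<Lambda> \<xi>) \<in> bounded_borel" for \<xi> :: "'s config"
    by (rule bounded_borel_indicator[OF cylb])
  have mem_iff: "x \<in> cyl \<Lambda> \<xi> \<longleftrightarrow> \<xi> = rep x" if "\<xi> \<in> \<Xi>" for \<xi> x
  proof
    assume "\<xi> = rep x"
    then have "cyl \<Lambda> \<xi> = cyl \<Lambda> x" by (simp only: rep(2))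
    then show "x \<in> cyl \<Lambda> \<xi>" by (simp only: cyl_self)
  qed (rule uniq[OF that])
  have decomp: "(\<Sum>\<xi>\<in>\<Xi>. q \<xi> * indicator (cyl \<Lambda> \<xi>) x) = q (rep x)"
    for q :: "'s config \<Rightarrow> real" and x
  proof -
    have "(\<Sum>\<xi>\<in>\<Xi>. q \<xi> * indicator (cyl \<Lambda> \<xi>) x) = (\<Sum>\<xi>\<in>\<Xi>. if \<xi> = rep x then q \<xi> else 0)"
      by (intro sum.cong refl) (simp add: indicator_def mem_iff)
    then show ?thesis using fin rep(1)[of x] by simp
  qed
  have kernel: "spec_kernel (\<lambda>_. \<psi>) \<Lambda> h x = (\<Sum>\<xi>\<in>\<Xi>. p \<xi> x * h (override_on x \<xi> \<Lambda>))" for h x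
    unfolding spec_kernel_def \<Xi>_def p_def by (rule sum_cyl_override[OF \<Lambda>(1)])
  have pb: "p \<xi> \<in> bounded_borel" for \<xi>
    unfolding p_def by (rule bounded_borel_override[OF \<psi>(1)])
  have pF: "p \<xi> \<in> borel_measurable F" for \<xi>
    unfolding F_def
  proof (rule measurable_coord_algebraI)
    show "p \<xi> \<in> borel_measurable borel" using pb by (simp add: bounded_borel_def)
    show "p \<xi> x = p \<xi> y" if "agree \<Delta> x y" for x y
      unfolding p_def by (intro \<psi>(2) agree_override that)
  qed
  have p_sum: "(\<Sum>\<xi>\<in>\<Xi>. p \<xi> x) = 1" for x
    using \<psi>(4)[of x] sum_cyl_override[OF \<Lambda>(1), of \<psi> x z] by (simp add: p_def \<Xi>_def)
  have ind_sum: "(\<Sum>\<xi>\<in>\<Xi>. indicator (cyl \<Lambda> \<xi>) x) = (1::real)" for x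
    using decomp[of "\<lambda>_. 1" x] by simp
  \<comment> \<open>The pattern-by-pattern form of \<open>C\<close>: the event is fixed before the
    point is chosen.\<close>
  define E where "E \<longleftrightarrow> (\<forall>\<xi>\<in>\<Xi>. AE x in \<mu>. e \<xi> x = p \<xi> x)"
  have EC: "E \<Longrightarrow> C"
  proof -
    assume E
    then have "AE x in \<mu>. \<forall>\<xi>\<in>\<Xi>. e \<xi> x = p \<xi> x" unfolding E_def by (intro AE_finite_allI fin) auto
    then show C unfolding C_def
    proof eventually_elim
      case (elim x)
      then have "e (rep x) x = p (rep x) x" using rep(1) by blast
      then show ?case by (simp add: e_def p_def rep F_def)
    qed
  qed
  have CE: "C \<Longrightarrow> E"
  proof -
    assume C: C
    \<comment> \<open>\<open>C\<close> only compares \<open>e \<xi>\<close> and \<open>p \<xi>\<close> on the cylinder of \<open>\<xi>\<close>. The event where they differ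
      has conditional probability \<open>e \<xi> = 0\<close> there, so \<open>e \<xi> \<le> p \<xi>\<close> throughout, and both sum to 1.\<close>
    have le: "AE x in \<mu>. e \<xi> x \<le> p \<xi> x" if "\<xi> \<in> \<Xi>" for \<xi>
    proof -
      define D where "D = {x \<in> space F. e \<xi> x \<noteq> p \<xi> x}"
      have eF: "e \<xi> \<in> borel_measurable F" by (simp add: e_def borel_measurable_cond_exp)
      have "D = (\<lambda>x. e \<xi> x - p \<xi> x) -` (- {0}) \<inter> space F" by (auto simp: D_def)
      then have DF: "D \<in> sets F"
        using measurable_sets[OF borel_measurable_diff[OF eF pF[of \<xi>]], of "- {0}"] by simp
      then have Db: "D \<in> sets borel" using subalg sets\<mu> by (auto simp: subalgebra_def)
      have int: "integrable \<mu> (\<lambda>x. indicator D x * indicator (cyl \<Lambda> \<xi>) x :: real)"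
        by (intro prob_integrable[OF \<mu>] bounded_borel_mult bounded_borel_indicator Db cylb)
      have "AE x in \<mu>. indicator D x * indicator (cyl \<Lambda> \<xi>) x = (0::real)"
        using C unfolding C_def
      proof eventually_elim
        case (elim x)
        show ?case
        proof (cases "x \<in> cyl \<Lambda> \<xi>")
          case True
          then have "\<xi> = rep x" using uniq that by blast
          then have "e \<xi> x = p \<xi> x" using elim by (simp add: e_def p_def rep F_def)
          then show ?thesis by (simp add: D_def)
        qed simp
      qed
      then have 0: "(\<integral>x. indicator D x * indicator (cyl \<Lambda> \<xi>) x \<partial>\<mu>) = (0::real)"
        by (rule integral_eq_zero_AE)
      have ind: "indicator (cyl \<Lambda> \<xi>) \<in> borel_measurable \<mu>"
        using cylb sets\<mu> by simp
      have "integrable \<mu> (\<lambda>x. indicator D x * e \<xi> x)" "(\<integral>x. indicator D x * e \<xi> x \<partial>\<mu>) = 0"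
        unfolding e_def using real_cond_exp_intg[OF int _ ind] DF 0 by auto
      moreover have e0: "AE x in \<mu>. 0 \<le> e \<xi> x"
        unfolding e_def by (rule real_cond_exp_pos) (use ind in auto)
      ultimately have "AE x in \<mu>. indicator D x * e \<xi> x = 0"
        by (subst integral_nonneg_eq_0_iff_AE[symmetric]) auto
      then show ?thesis
      proof eventually_elim
        case (elim x)
        show ?case
        proof (cases "x \<in> D")
          case True
          then show ?thesis using elim \<psi>(3) by (simp add: p_def)
        next
          case False
          then show ?thesis by (simp add: D_def F_def)
        qed
      qed
    qed
    have "AE x in \<mu>. real_cond_exp \<mu> F (\<lambda>x. \<Sum>\<xi>\<in>\<Xi>. indicator (cyl \<Lambda> \<xi>) x) x = (\<Sum>\<xi>\<in>\<Xi>. e \<xi> x)"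
      unfolding e_def by (rule real_cond_exp_sum) (rule prob_integrable[OF \<mu> indb])
    moreover have "AE x in \<mu>. real_cond_exp \<mu> F (\<lambda>x. 1) x = 1"
      by (rule real_cond_exp_F_meas) auto
    moreover have "AE x in \<mu>. \<forall>\<xi>\<in>\<Xi>. e \<xi> x \<le> p \<xi> x"
      by (intro AE_finite_allI fin le)
    ultimately have "AE x in \<mu>. \<forall>\<xi>\<in>\<Xi>. e \<xi> x = p \<xi> x"
    proof eventually_elim
      case (elim x)
      have "(\<Sum>\<xi>\<in>\<Xi>. p \<xi> x - e \<xi> x) = 0"
        using elim unfolding ind_sum by (simp add: sum_subtractf p_sum)
      then have "\<forall>\<xi>\<in>\<Xi>. p \<xi> x - e \<xi> x = 0"
        using elim(3) fin by (subst (asm) sum_nonneg_eq_0_iff) auto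
      then show ?case by simp
    qed
    then show E unfolding E_def by auto
  qed
  show "(\<integral>x. spec_kernel (\<lambda>_. \<psi>) \<Lambda> h x \<partial>\<mu>) = (\<integral>x. h x \<partial>\<mu>)"
    if C and h: "h \<in> bounded_borel" and ag: "\<And>x y. agree (\<Delta> \<union> \<Lambda>) x y \<Longrightarrow> h x = h y" for h
  proof -
    from \<open>C\<close> have E by (rule CE)
    define k where "k \<xi> x = h (override_on x \<xi> \<Lambda>)" for \<xi> x
    have kb: "k \<xi> \<in> bounded_borel" for \<xi>
      unfolding k_def by (rule bounded_borel_override[OF h])
    \<comment> \<open>With the coordinates in \<open>\<Lambda>\<close> overridden, \<open>h\<close>
      depends on \<open>\<Delta>\<close> only and can be taken out of the conditional
      expectation.\<close>
    have kF: "k \<xi> \<in> borel_measurable F" for \<xi>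
      unfolding F_def
    proof (rule measurable_coord_algebraI)
      show "k \<xi> \<in> borel_measurable borel" using kb by (simp add: bounded_borel_def)
      show "k \<xi> x = k \<xi> y" if "agree \<Delta> x y" for x y
        unfolding k_def by (intro ag agree_override that)
    qed
    have eq: "(\<integral>x. k \<xi> x * p \<xi> x \<partial>\<mu>) = (\<integral>x. k \<xi> x * indicator (cyl \<Lambda> \<xi>) x \<partial>\<mu>)" if "\<xi> \<in> \<Xi>" for \<xi>
    proof -
      have ind: "indicator (cyl \<Lambda> \<xi>) \<in> borel_measurable \<mu>"
        using cylb sets\<mu> by simp
      have int: "integrable \<mu> (\<lambda>x. k \<xi> x * indicator (cyl \<Lambda> \<xi>) x)"
        by (rule prob_integrable[OF \<mu> bounded_borel_mult[OF kb indb]])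
      have meas: "k \<xi> \<in> borel_measurable \<mu>" "p \<xi> \<in> borel_measurable \<mu>"
        using kb pb \<mu> by (simp_all add: bounded_borel_def prob_borel_measurable)
      have "e \<xi> \<in> borel_measurable \<mu>" by (simp add: e_def)
      note meas = meas this
      have "(\<integral>x. k \<xi> x * p \<xi> x \<partial>\<mu>) = (\<integral>x. k \<xi> x * e \<xi> x \<partial>\<mu>)"
        using \<open>E\<close> that meas unfolding E_def by (intro integral_cong_AE) auto
      also have "\<dots> = (\<integral>x. k \<xi> x * indicator (cyl \<Lambda> \<xi>) x \<partial>\<mu>)"
        unfolding e_def by (rule real_cond_exp_intg(2)[OF int kF ind])
      finally show ?thesis .
    qed
    have "(\<integral>x. spec_kernel (\<lambda>_. \<psi>) \<Lambda> h x \<partial>\<mu>) = (\<integral>x. (\<Sum>\<xi>\<in>\<Xi>. k \<xi> x * p \<xi> x) \<partial>\<mu>)"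
      unfolding kernel k_def by (simp add: mult.commute)
    also have "\<dots> = (\<Sum>\<xi>\<in>\<Xi>. \<integral>x. k \<xi> x * p \<xi> x \<partial>\<mu>)"
      by (rule Bochner_Integration.integral_sum) (rule prob_integrable[OF \<mu> bounded_borel_mult[OF kb pb]])
    also have "\<dots> = (\<Sum>\<xi>\<in>\<Xi>. \<integral>x. k \<xi> x * indicator (cyl \<Lambda> \<xi>) x \<partial>\<mu>)"
      by (rule sum.cong[OF refl eq])
    also have "\<dots> = (\<integral>x. (\<Sum>\<xi>\<in>\<Xi>. k \<xi> x * indicator (cyl \<Lambda> \<xi>) x) \<partial>\<mu>)"
      by (rule Bochner_Integration.integral_sum[symmetric])
        (rule prob_integrable[OF \<mu> bounded_borel_mult[OF kb indb]])
    also have "(\<lambda>x. \<Sum>\<xi>\<in>\<Xi>. k \<xi> x * indicator (cyl \<Lambda> \<xi>) x) = h"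
    proof
      fix x
      show "(\<Sum>\<xi>\<in>\<Xi>. k \<xi> x * indicator (cyl \<Lambda> \<xi>) x) = h x"
        using decomp[of "\<lambda>\<xi>. h (override_on x \<xi> \<Lambda>)" x] unfolding k_def rep(3) .
    qed
    finally show ?thesis .
  qed
  show C
    if I: "\<And>B. B \<in> sets borel \<Longrightarrow> (\<And>x y. agree (\<Delta> \<union> \<Lambda>) x y \<Longrightarrow> x \<in> B \<longleftrightarrow> y \<in> B) \<Longrightarrow>
      (\<integral>x. spec_kernel (\<lambda>_. \<psi>) \<Lambda> (indicator B) x \<partial>\<mu>) = measure \<mu> B"
  proof (rule EC, unfold E_def, rule ballI)
    fix \<xi> assume \<xi>: "\<xi> \<in> \<Xi>"
    show "AE x in \<mu>. e \<xi> x = p \<xi> x"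
      unfolding e_def
    proof (rule real_cond_exp_charact)
      show "integrable \<mu> (indicator (cyl \<Lambda> \<xi>) :: _ \<Rightarrow> real)" "integrable \<mu> (p \<xi>)" "p \<xi> \<in> borel_measurable F"
        by (rule prob_integrable[OF \<mu>] indb pb pF)+
      fix A assume A: "A \<in> sets F"
      then have Ab: "A \<in> sets borel" using subalg sets\<mu> by (auto simp: subalgebra_def)
      define B where "B = A \<inter> cyl \<Lambda> \<xi>"
      have agA: "x \<in> A \<longleftrightarrow> y \<in> A" if "agree \<Delta> x y" for x y
        using coord_algebra_sets_agree[OF A[unfolded F_def] that] .
      have Bb: "B \<in> sets borel" unfolding B_def by (rule sets.Int[OF Ab cylb])
      have inv: "x \<in> B \<longleftrightarrow> y \<in> B" if ag: "agree (\<Delta> \<union> \<Lambda>) x y" for x y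
      proof -
        have 1: "agree \<Delta> x y" by (rule agree_mono[OF ag]) simp
        have "agree \<Lambda> x y" by (rule agree_mono[OF ag]) simp
        then have "x \<in> cyl \<Lambda> \<xi> \<longleftrightarrow> y \<in> cyl \<Lambda> \<xi>"
          unfolding cyl_def mem_Collect_eq by (rule fun_cong[OF agree_cong])
        with agA[OF 1] show ?thesis by (simp add: B_def)
      qed
      have "(\<integral>x. spec_kernel (\<lambda>_. \<psi>) \<Lambda> (indicator B) x \<partial>\<mu>) = measure \<mu> B"
        by (rule I[OF Bb inv])
      \<comment> \<open>Overriding on \<open>\<Lambda>\<close> does not change membership in
        \<open>A\<close>, since \<open>\<Lambda>\<close> and \<open>\<Delta>\<close> are disjoint,
        so only the pattern \<open>\<xi>\<close> contributes. Invariance for \<open>B\<close> thus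
        becomes the defining identity of the conditional expectation on \<open>A\<close>.\<close>
      moreover have "spec_kernel (\<lambda>_. \<psi>) \<Lambda> (indicator B) x = indicator A x * p \<xi> x" for x
      proof -
        have "indicator B (override_on x \<xi>' \<Lambda>) = (if \<xi>' = \<xi> then indicator A x else (0::real))" if "\<xi>' \<in> \<Xi>" for \<xi>'
        proof -
          have "override_on x \<xi>' \<Lambda> \<in> A \<longleftrightarrow> x \<in> A"
            by (rule agA, rule agreeI) (use \<Lambda>(2) in \<open>auto simp: override_on_def\<close>)
          moreover have "override_on x \<xi>' \<Lambda> \<in> cyl \<Lambda> \<xi> \<longleftrightarrow> \<xi>' = \<xi>"
          proof
            assume "override_on x \<xi>' \<Lambda> \<in> cyl \<Lambda> \<xi>"
            then have *: "agree \<Lambda> (override_on x \<xi>' \<Lambda>) \<xi>" by (simp add: cyl_def)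
            show "\<xi>' = \<xi>"
            proof
              fix i
              show "\<xi>' i = \<xi> i"
                using \<xi> that agreeD[OF *, of i]
                by (cases "i \<in> \<Lambda>") (simp_all add: \<Xi>_def mem_cyl_Compl)
            qed
          qed (simp add: cyl_def agree_def)
          ultimately show ?thesis by (simp add: B_def indicator_def)
        qed
        then have "spec_kernel (\<lambda>_. \<psi>) \<Lambda> (indicator B) x = (\<Sum>\<xi>'\<in>\<Xi>. if \<xi>' = \<xi> then p \<xi>' x * indicator A x else 0)"
          unfolding kernel by (intro sum.cong) auto
        then show ?thesis using fin \<xi> by simp
      qed
      moreover have "(\<integral>x\<in>A. indicator (cyl \<Lambda> \<xi>) x \<partial>\<mu>) = measure \<mu> B"
        using space\<mu> by (simp add: set_lebesgue_integral_def B_def indicator_inter_arith[symmetric])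
      ultimately show "(\<integral>x\<in>A. indicator (cyl \<Lambda> \<xi>) x \<partial>\<mu>) = (\<integral>x\<in>A. p \<xi> x \<partial>\<mu>)"
        by (simp add: set_lebesgue_integral_def)
    qed
  qed
qed

section \<open>Compactness, uniform continuity and the generating cylinders\<close>

lemma agree_UNIV [simp]: "agree UNIV x y \<longleftrightarrow> x = y"
  by (auto simp: agree_def)

lemma compact_config: "compact (UNIV :: 's::{finite,topological_space} config set)"
proof -
  have "compact_space (product_topology (\<lambda>_ :: int. euclidean :: 's topology) UNIV)"
    unfolding compact_space_product_topology by (simp add: compact_space_def finite_imp_compact)
  then show ?thesis
    by (simp add: euclidean_product_topology compact_space_def)
qed

text \<open>Heine-Cantor with cylinders in place of balls: finitely many cylinders on which
  \<open>k\<close> stays within \<open>e / 2\<close> of its value at the centre cover the space, and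
  the largest radius works.\<close>

lemma uniformly_continuous_config:
  fixes k :: "'s::{finite,discrete_topology} config \<Rightarrow> real"
  assumes "continuous_on UNIV k" "0 < e"
  obtains n :: nat where "\<And>x y. agree {- int n..int n} x y \<Longrightarrow> \<bar>k x - k y\<bar> < e"
proof -
  have "\<exists>n::nat. \<forall>y\<in>cyl {- int n..int n} x. \<bar>k y - k x\<bar> < e / 2" for x
  proof -
    have "open (k -` {k x - e / 2<..<k x + e / 2})"
      using assms(1) by (intro open_vimage) auto
    moreover have "x \<in> k -` {k x - e / 2<..<k x + e / 2}" using assms(2) by simp
    ultimately obtain n :: nat where "cyl {- int n..int n} x \<subseteq> k -` {k x - e / 2<..<k x + e / 2}"
      by (rule open_contains_cyl)
    then have sub: "y \<in> k -` {k x - e / 2<..<k x + e / 2}" if "y \<in> cyl {- int n..int n} x" for y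
      using that by (rule subsetD)
    have "\<bar>k y - k x\<bar> < e / 2" if "y \<in> cyl {- int n..int n} x" for y
      using sub[OF that] unfolding vimage_eq greaterThanLessThan_iff abs_less_iff by linarith
    then have "\<forall>y\<in>cyl {- int n..int n} x. \<bar>k y - k x\<bar> < e / 2" by blast
    then show ?thesis ..
  qed
  then obtain r :: "'s config \<Rightarrow> nat"
    where r: "\<And>x y. y \<in> cyl {- int (r x)..int (r x)} x \<Longrightarrow> \<bar>k y - k x\<bar> < e / 2"
    by metis
  have "open (cyl {- int (r x)..int (r x)} x)" for x
  proof -
    have eq: "cyl {- int (r x)..int (r x)} x = (\<Inter>i\<in>{- int (r x)..int (r x)}. (\<lambda>y. y i) -` {x i})"
      by (auto simp: cyl_def agree_def)
    show ?thesis unfolding eq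
      by (intro open_INT ballI open_vimage Topological_Spaces.open_discrete
          continuous_on_product_coordinates) simp
  qed
  moreover have "UNIV \<subseteq> (\<Union>x\<in>UNIV. cyl {- int (r x)..int (r x)} x)" using cyl_self by blast
  ultimately obtain D where D: "finite D" "UNIV \<subseteq> (\<Union>x\<in>D. cyl {- int (r x)..int (r x)} x)"
    by (rule compactE_image[OF compact_config])
  define n where "n = Max (insert 0 (r ` D))"
  show thesis
  proof (rule that[of n])
    fix x y :: "'s config" assume ag: "agree {- int n..int n} x y"
    obtain w where w: "w \<in> D" "x \<in> cyl {- int (r w)..int (r w)} w" using D(2) by blast
    have "r w \<le> n" unfolding n_def using w(1) D(1) by (intro Max_ge) auto
    then have "agree {- int (r w)..int (r w)} y x"
      by (intro agree_sym[OF agree_mono[OF ag]]) auto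
    then have "y \<in> cyl {- int (r w)..int (r w)} w"
      using w(2) agree_trans unfolding cyl_def by blast
    then show "\<bar>k x - k y\<bar> < e" using r[OF w(2)] r[of y w] by linarith
  qed
qed

lemma borel_eq_sigma_cyl:
  "sets (borel :: 's::{finite,discrete_topology} config measure) =
    sigma_sets UNIV (insert {} {cyl \<Lambda> x | \<Lambda> x. finite \<Lambda>})" (is "_ = sigma_sets UNIV ?G")
proof
  have "{{x :: 's config. x i = s} | i s. i \<in> UNIV} \<subseteq> ?G"
  proof
    fix A assume "A \<in> {{x :: 's config. x i = s} | i s. i \<in> UNIV}"
    then obtain i s where "A = {x :: 's config. x i = s}" by blast
    then have "A = cyl {i} (\<lambda>_. s)" by (auto simp: cyl_def agree_def)
    moreover have "finite {i}" by simp
    ultimately show "A \<in> ?G" by blast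
  qed
  then show "sets (borel :: 's config measure) \<subseteq> sigma_sets UNIV ?G"
    unfolding borel_eq_coord_algebra coord_algebra_sets by (rule sigma_sets_mono')
  have "?G \<subseteq> sets (coord_algebra UNIV)"
    using cyl_in_coord_algebra by blast
  then show "sigma_sets UNIV ?G \<subseteq> sets (borel :: 's config measure)"
    unfolding borel_eq_coord_algebra
    using sets.sigma_sets_subset[of ?G "coord_algebra UNIV :: 's config measure"] by simp
qed

text \<open>Two cylinders with a common point can both be based at that point; the empty set is
  included for disjoint ones.\<close>

lemma Int_stable_cyl: "Int_stable (insert {} {cyl \<Lambda> x | \<Lambda> (x :: 's config). finite \<Lambda>})"
proof (rule Int_stableI)
  fix A B :: "'s config set"
  assume A: "A \<in> insert {} {cyl \<Lambda> x | \<Lambda> x. finite \<Lambda>}" and B: "B \<in> insert {} {cyl \<Lambda> x | \<Lambda> x. finite \<Lambda>}"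
  show "A \<inter> B \<in> insert {} {cyl \<Lambda> x | \<Lambda> x. finite \<Lambda>}"
  proof (cases "A \<inter> B = {}")
    case False
    then obtain w where w: "w \<in> A" "w \<in> B" by blast
    then obtain \<Lambda> x \<Lambda>' x' where "A = cyl \<Lambda> x" "finite \<Lambda>" "B = cyl \<Lambda>' x'" "finite \<Lambda>'"
      using A B by blast
    moreover from this w have "A = cyl \<Lambda> w" "B = cyl \<Lambda>' w" using cyl_eqI by blast+
    moreover have "cyl \<Lambda> w \<inter> cyl \<Lambda>' w = cyl (\<Lambda> \<union> \<Lambda>') w" by (auto simp: cyl_def agree_def)
    ultimately have "A \<inter> B = cyl (\<Lambda> \<union> \<Lambda>') w" "finite (\<Lambda> \<union> \<Lambda>')" by auto
    then show ?thesis by blast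
  qed simp
qed

section \<open>Kernels of the specification and invariance of Gibbs states\<close>

context sequenced_spec
begin

lemma phi_le_1:
  assumes "\<Lambda> \<in> finite_nonempty"
  shows "\<phi> \<Lambda> x \<le> 1"
proof -
  have "\<phi> \<Lambda> x \<le> (\<Sum>y\<in>cyl (- \<Lambda>) x. \<phi> \<Lambda> y)"
    using assms by (intro member_le_sum) (auto simp: phi_nonneg finite_nonempty_def)
  then show ?thesis using phi_sum[OF assms] by simp
qed

lemma phi_bounded_borel: "\<Lambda> \<in> finite_nonempty \<Longrightarrow> \<phi> \<Lambda> \<in> bounded_borel"
  using phi_nonneg[of \<Lambda>] phi_le_1[of \<Lambda>]
  by (intro bounded_borelI[where B = 1] borel_measurable_continuous_onI phi_cont) auto

lemma kernel_diff:
  "spec_kernel \<phi> \<Lambda> h x - spec_kernel \<phi> \<Lambda> k x = spec_kernel \<phi> \<Lambda> (\<lambda>y. h y - k y) x"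
  by (simp add: spec_kernel_def sum_subtractf right_diff_distrib)

lemma kernel_bound:
  assumes "\<Lambda> \<in> finite_nonempty" "\<And>y. \<bar>h y\<bar> \<le> B"
  shows "\<bar>spec_kernel \<phi> \<Lambda> h x\<bar> \<le> B"
proof -
  have "\<bar>spec_kernel \<phi> \<Lambda> h x\<bar> \<le> (\<Sum>y\<in>cyl (- \<Lambda>) x. \<bar>\<phi> \<Lambda> y * h y\<bar>)"
    unfolding spec_kernel_def by (rule sum_abs)
  also have "\<dots> \<le> (\<Sum>y\<in>cyl (- \<Lambda>) x. \<phi> \<Lambda> y * B)"
    using phi_nonneg[OF assms(1)] assms(2) by (intro sum_mono) (simp add: abs_mult mult_left_mono)
  also have "\<dots> = B" by (simp add: sum_distrib_right[symmetric] phi_sum[OF assms(1)])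
  finally show ?thesis .
qed

lemma kernel_close:
  assumes "\<Lambda> \<in> finite_nonempty" "\<And>y. \<bar>h y - k y\<bar> \<le> e"
  shows "\<bar>spec_kernel \<phi> \<Lambda> h x - spec_kernel \<phi> \<Lambda> k x\<bar> \<le> e"
  unfolding kernel_diff by (rule kernel_bound[OF assms])

lemma kernel_fixed:
  assumes "\<Lambda> \<in> finite_nonempty" "\<And>y. y \<in> cyl (- \<Lambda>) x \<Longrightarrow> h y = h x"
  shows "spec_kernel \<phi> \<Lambda> h x = h x"
proof -
  have "spec_kernel \<phi> \<Lambda> h x = (\<Sum>y\<in>cyl (- \<Lambda>) x. \<phi> \<Lambda> y * h x)"
    unfolding spec_kernel_def
    by (rule sum.cong[OF refl], rule arg_cong2[OF refl], rule assms(2))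
  then show ?thesis by (simp add: sum_distrib_right[symmetric] phi_sum[OF assms(1)])
qed

lemma kernel_bounded_borel:
  assumes "\<Lambda> \<in> finite_nonempty" "h \<in> bounded_borel"
  shows "spec_kernel \<phi> \<Lambda> h \<in> bounded_borel"
proof -
  obtain B where B: "h \<in> borel_measurable borel" "\<And>x. \<bar>h x\<bar> \<le> B"
    using assms(2) by (rule bounded_borelE) blast
  show ?thesis
  proof (rule bounded_borelI[OF _ kernel_bound[OF assms(1) B(2)]])
    have fin: "finite \<Lambda>" using assms(1) by (simp add: finite_nonempty_def)
    have "spec_kernel \<phi> \<Lambda> h = (\<lambda>x. \<Sum>\<xi>\<in>cyl (- \<Lambda>) undefined.
        (\<lambda>y. \<phi> \<Lambda> y * h y) (override_on x \<xi> \<Lambda>))"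
      unfolding spec_kernel_def by (rule ext) (rule sum_cyl_override[OF fin])
    also have "\<dots> \<in> borel_measurable borel"
      using bounded_borel_override[OF bounded_borel_mult[OF phi_bounded_borel[OF assms(1)] assms(2)]]
      by (intro borel_measurable_sum) (simp add: bounded_borel_def)
    finally show "spec_kernel \<phi> \<Lambda> h \<in> borel_measurable borel" .
  qed
qed

lemma kernel_cont:
  assumes "\<Lambda> \<in> finite_nonempty" "continuous_on UNIV h"
  shows "continuous_on UNIV (spec_kernel \<phi> \<Lambda> h)"
  unfolding spec_kernel_def[abs_def]
  using assms by (intro continuous_on_sum_cyl continuous_on_mult phi_cont) (auto simp: finite_nonempty_def)

text \<open>After the double sum is exchanged, the inner sum is the right-hand side of the
  consistency identity of the specification at \<open>w\<close>.\<close>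

lemma kernel_consistent:
  assumes \<Lambda>: "\<Lambda> \<in> finite_nonempty" and K: "K \<noteq> {}" "K \<subseteq> \<Lambda>"
  shows "spec_kernel \<phi> \<Lambda> (spec_kernel \<phi> K h) x = spec_kernel \<phi> \<Lambda> h x"
proof -
  let ?C = "cyl (- \<Lambda>) x"
  have fin: "finite ?C" using \<Lambda> by (simp add: finite_nonempty_def)
  have eq: "cyl (- K) y = {w \<in> ?C. agree (- K) w y}" if "y \<in> ?C" for y
  proof -
    have "agree (- \<Lambda>) w x" if "agree (- K) w y" for w
    proof (rule agree_trans)
      show "agree (- \<Lambda>) w y" using that K by (intro agree_mono[OF that]) auto
      show "agree (- \<Lambda>) y x" using \<open>y \<in> ?C\<close> by (simp add: cyl_def)
    qed
    then show ?thesis by (auto simp: cyl_def)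
  qed
  have "spec_kernel \<phi> \<Lambda> (spec_kernel \<phi> K h) x =
      (\<Sum>y\<in>?C. \<Sum>w\<in>{w \<in> ?C. agree (- K) w y}. \<phi> \<Lambda> y * (\<phi> K w * h w))"
    unfolding spec_kernel_def by (simp add: eq sum_distrib_left)
  also have "\<dots> = (\<Sum>w\<in>?C. \<Sum>y\<in>{y \<in> ?C. agree (- K) w y}. \<phi> \<Lambda> y * (\<phi> K w * h w))"
    by (rule sum.swap_restrict[OF fin fin])
  also have "\<dots> = (\<Sum>w\<in>?C. (\<phi> K w * (\<Sum>y\<in>cyl (- K) w. \<phi> \<Lambda> y)) * h w)"
  proof (rule sum.cong[OF refl])
    fix w assume w: "w \<in> ?C"
    have "{y \<in> ?C. agree (- K) w y} = cyl (- K) w"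
      unfolding eq[OF w] using agree_sym by blast
    then show "(\<Sum>y\<in>{y \<in> ?C. agree (- K) w y}. \<phi> \<Lambda> y * (\<phi> K w * h w)) =
        (\<phi> K w * (\<Sum>y\<in>cyl (- K) w. \<phi> \<Lambda> y)) * h w"
      by (simp add: sum_distrib_right sum_distrib_left mult_ac)
  qed
  also have "\<dots> = (\<Sum>w\<in>?C. \<phi> \<Lambda> w * h w)"
    using spec \<Lambda> K unfolding is_specification_def by (intro sum.cong refl) metis
  finally show ?thesis by (simp add: spec_kernel_def)
qed

lemma gibbs_kernel:
  assumes "prob_measure_on_X \<mu>" "gibbs_state \<phi> \<mu>" "\<Lambda> \<in> finite_nonempty" "h \<in> bounded_borel"
  shows "(\<integral>x. spec_kernel \<phi> \<Lambda> h x \<partial>\<mu>) = (\<integral>x. h x \<partial>\<mu>)"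
proof -
  have "(\<integral>x. spec_kernel (\<lambda>_. \<phi> \<Lambda>) \<Lambda> h x \<partial>\<mu>) = (\<integral>x. h x \<partial>\<mu>)"
    using assms phi_bounded_borel[OF assms(3)]
    by (intro cond_prob_kernel(1)[where \<Delta> = "- \<Lambda>"])
      (auto simp: finite_nonempty_def gibbs_state_def phi_nonneg phi_sum)
  then show ?thesis by (simp add: spec_kernel_def)
qed

text \<open>Finite cylinders form an intersection-stable generator, so invariance extends from them
  to all Borel sets by Dynkin's theorem. This suffices because \<open>\<Lambda>\<close> and its
  complement exhaust the coordinates.\<close>

lemma gibbs_stateI:
  assumes \<mu>: "prob_measure_on_X \<mu>"
    and inv: "\<And>\<Lambda> D w. \<Lambda> \<in> finite_nonempty \<Longrightarrow> finite D \<Longrightarrow>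
      (\<integral>x. spec_kernel \<phi> \<Lambda> (indicator (cyl D w)) x \<partial>\<mu>) = measure \<mu> (cyl D w)"
  shows "gibbs_state \<phi> \<mu>"
  unfolding gibbs_state_def
proof (intro conjI ballI \<mu>)
  fix \<Lambda> assume \<Lambda>: "\<Lambda> \<in> finite_nonempty"
  interpret prob_space \<mu> using \<mu> by (simp add: prob_measure_on_X_def)
  have sets\<mu>: "sets \<mu> = sets borel" using \<mu> by (simp add: prob_measure_on_X_def)
  then have space\<mu>: "space \<mu> = UNIV" using sets_eq_imp_space_eq by fastforce
  have eq: "(\<integral>x. spec_kernel \<phi> \<Lambda> (indicator B) x \<partial>\<mu>) = measure \<mu> B" if "B \<in> sets borel" for B
    using Int_stable_cyl Pow_UNIV[THEN equalityD2, THEN subset_trans[OF subset_UNIV]]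
      that[unfolded borel_eq_sigma_cyl]
  proof (induction rule: sigma_sets_induct_disjoint)
    case (basic A)
    then show ?case using inv[OF \<Lambda>] by (auto simp: spec_kernel_def)
  next
    case empty
    then show ?case by (simp add: spec_kernel_def)
  next
    case (compl A)
    then have A: "A \<in> sets borel" by (simp only: borel_eq_sigma_cyl)
    have "spec_kernel \<phi> \<Lambda> (indicator (UNIV - A)) x = 1 - spec_kernel \<phi> \<Lambda> (indicator A) x" for x
      using kernel_fixed[OF \<Lambda>, of x "\<lambda>_. 1"] kernel_diff[of \<Lambda> "\<lambda>_. 1" x "indicator A"]
      by (simp add: indicator_diff[of A UNIV] spec_kernel_def indicator_compl Compl_eq_Diff_UNIV[symmetric])
    then show ?case
      using compl.IH A prob_integrable[OF \<mu> kernel_bounded_borel[OF \<Lambda> bounded_borel_indicator[OF A]]]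
        prob_compl[of A] prob_space by (simp add: sets\<mu> space\<mu>)
  next
    case (union A)
    then have A: "A i \<in> sets borel" for i by (auto simp: borel_eq_sigma_cyl)
    have int: "integrable \<mu> (spec_kernel \<phi> \<Lambda> (indicator (A i)))" for i
      by (rule prob_integrable[OF \<mu> kernel_bounded_borel[OF \<Lambda> bounded_borel_indicator[OF A]]])
    have ker: "spec_kernel \<phi> \<Lambda> (\<lambda>y. \<Sum>i<n. indicator (A i) y) x =
        (\<Sum>i<n. spec_kernel \<phi> \<Lambda> (indicator (A i)) x)" for n x
      unfolding spec_kernel_def sum_distrib_left by (rule sum.swap)
    have sums: "(\<lambda>i. indicator (A i) y) sums (indicator (\<Union>i. A i) y :: real)" for y
      by (rule indicator_sums) (use union(1) in \<open>auto simp: disjoint_family_on_def\<close>)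
    have "(\<lambda>n. \<integral>x. spec_kernel \<phi> \<Lambda> (\<lambda>y. \<Sum>i<n. indicator (A i) y) x \<partial>\<mu>) \<longlonglongrightarrow>
        (\<integral>x. spec_kernel \<phi> \<Lambda> (indicator (\<Union>i. A i)) x \<partial>\<mu>)"
    proof (rule integral_dominated_convergence[where w = "\<lambda>_. 1"])
      have "spec_kernel \<phi> \<Lambda> (indicator (\<Union>i. A i)) \<in> bounded_borel"
        by (rule kernel_bounded_borel[OF \<Lambda> bounded_borel_indicator]) (use A in blast)
      then show "spec_kernel \<phi> \<Lambda> (indicator (\<Union>i. A i)) \<in> borel_measurable \<mu>"
        using \<mu> by (simp add: prob_borel_measurable bounded_borel_def)
      show "(\<lambda>x. spec_kernel \<phi> \<Lambda> (\<lambda>y. \<Sum>i<n. indicator (A i) y) x) \<in> borel_measurable \<mu>" for n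
        unfolding ker using int by (intro borel_measurable_sum borel_measurable_integrable)
      show "AE x in \<mu>. (\<lambda>n. spec_kernel \<phi> \<Lambda> (\<lambda>y. \<Sum>i<n. indicator (A i) y) x) \<longlonglongrightarrow>
          spec_kernel \<phi> \<Lambda> (indicator (\<Union>i. A i)) x"
        unfolding spec_kernel_def
        by (intro AE_I2 tendsto_sum tendsto_mult tendsto_const sums[unfolded sums_def])
      \<comment> \<open>The sets are disjoint, so partial sums of their indicators are at most
        \<open>1\<close>, and the kernel preserves this bound.\<close>
      show "AE x in \<mu>. norm (spec_kernel \<phi> \<Lambda> (\<lambda>y. \<Sum>i<n. indicator (A i) y) x) \<le> 1" for n
      proof (rule AE_I2)
        fix x
        have "\<bar>\<Sum>i<n. indicator (A i) y\<bar> \<le> (1 :: real)" for y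
        proof -
          have "(\<Sum>i<n. indicator (A i) y :: real) \<le> indicator (\<Union>i. A i) y"
            using sum_le_suminf[OF sums_summable[OF sums[of y]], of "{..<n}"] sums_unique[OF sums[of y]]
            by simp
          moreover have "indicator (\<Union>i. A i) y \<le> (1 :: real)" by (simp add: indicator_def)
          moreover have "0 \<le> (\<Sum>i<n. indicator (A i) y :: real)" by (intro sum_nonneg) simp
          ultimately show ?thesis by linarith
        qed
        then show "norm (spec_kernel \<phi> \<Lambda> (\<lambda>y. \<Sum>i<n. indicator (A i) y) x) \<le> 1"
          unfolding real_norm_def by (rule kernel_bound[OF \<Lambda>])
      qed
    qed simp
    moreover have "(\<integral>x. spec_kernel \<phi> \<Lambda> (\<lambda>y. \<Sum>i<n. indicator (A i) y) x \<partial>\<mu>) =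
        (\<Sum>i<n. measure \<mu> (A i))" for n
      unfolding ker by (simp add: int union(3))
    ultimately have "(\<lambda>i. measure \<mu> (A i)) sums (\<integral>x. spec_kernel \<phi> \<Lambda> (indicator (\<Union>i. A i)) x \<partial>\<mu>)"
      by (simp add: sums_def)
    moreover have "(\<lambda>i. measure \<mu> (A i)) sums measure \<mu> (\<Union>i. A i)"
      using union(1) A by (intro finite_measure_UNION) (auto simp: sets\<mu>)
    ultimately show ?case by (rule sums_unique2)
  qed
  show "AE x in \<mu>. real_cond_exp \<mu> (coord_algebra (- \<Lambda>)) (indicator (cyl \<Lambda> x)) x = \<phi> \<Lambda> x"
    using \<Lambda> phi_bounded_borel[OF \<Lambda>] eq
    by (intro cond_prob_kernel(2)[OF \<mu>])
      (auto simp: finite_nonempty_def phi_nonneg phi_sum spec_kernel_def)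
qed

end

section \<open>Gibbs states and chains\<close>

lemma prob_integral_close:
  assumes \<mu>: "prob_measure_on_X \<mu>" and h: "h \<in> bounded_borel" and k: "k \<in> bounded_borel"
    and le: "\<And>x. \<bar>h x - k x\<bar> \<le> e"
  shows "\<bar>(\<integral>x. h x \<partial>\<mu>) - (\<integral>x. k x \<partial>\<mu>)\<bar> \<le> e"
proof -
  interpret prob_space \<mu> using \<mu> by (simp add: prob_measure_on_X_def)
  have int: "integrable \<mu> h" "integrable \<mu> k" using prob_integrable[OF \<mu>] h k by auto
  have "\<bar>(\<integral>x. h x \<partial>\<mu>) - (\<integral>x. k x \<partial>\<mu>)\<bar> = \<bar>\<integral>x. h x - k x \<partial>\<mu>\<bar>"
    using int by simp
  also have "\<dots> \<le> (\<integral>x. \<bar>h x - k x\<bar> \<partial>\<mu>)"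
    by (rule integral_abs_bound)
  also have "\<dots> \<le> (\<integral>x. e \<partial>\<mu>)"
    using int le by (intro integral_mono) auto
  also have "\<dots> = e" by (simp add: prob_space)
  finally show ?thesis .
qed

lemma finite_int_interval:
  assumes "finite (A :: int set)"
  obtains b :: nat where "A \<subseteq> {- int b..int b}"
proof
  define b where "b = Max (insert 0 ((\<lambda>i. nat \<bar>i\<bar>) ` A))"
  show "A \<subseteq> {- int b..int b}"
  proof
    fix i assume "i \<in> A"
    then have "nat \<bar>i\<bar> \<le> b" unfolding b_def using assms by (intro Max_ge) auto
    then show "i \<in> {- int b..int b}" by auto
  qed
qed

lemma continuous_on_indicator_cyl:
  assumes "finite D"
  shows "continuous_on UNIV (indicator (cyl D w) :: 's::discrete_topology config \<Rightarrow> real)"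
proof -
  have "indicator (cyl D w) x = (\<Prod>i\<in>D. of_bool (x i = w i) :: real)" for x
  proof (cases "x \<in> cyl D w")
    case True
    then show ?thesis by (simp add: cyl_def agree_def)
  next
    case False
    then obtain i where "i \<in> D" "x i \<noteq> w i" by (auto simp: cyl_def agree_def)
    then have "(\<Prod>i\<in>D. of_bool (x i = w i) :: real) = 0"
      using assms by (intro prod_zero bexI[of _ i]) auto
    then show ?thesis using False by simp
  qed
  moreover have "continuous_on UNIV (\<lambda>x. of_bool (x i = w i) :: real)" for i
  proof -
    have "continuous_on UNIV (\<lambda>s :: 's. of_bool (s = w i) :: real)"
      by (rule Topological_Spaces.continuous_on_discrete)
    from continuous_on_compose2[OF this continuous_on_product_coordinates[of i]]
    show ?thesis by simp
  qed
  ultimately show ?thesis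
    using continuous_on_prod[of D UNIV "\<lambda>i x. of_bool (x i = w i) :: real"]
    by (simp add: fun_eq_iff[symmetric] cong: continuous_on_cong)
qed

lemma continuous_on_shift_pow: "continuous_on UNIV (shift_pow n :: 's::topological_space config \<Rightarrow> _)"
  unfolding shift_pow_def[abs_def]
  by (rule continuous_on_coordinatewise_then_product) simp

lemma shift_pow_upd: "shift_pow n (x(n := s)) = (shift_pow n x)(0 := s)"
  by (auto simp: shift_pow_def fun_eq_iff)

context sequenced_spec
begin

text \<open>Shift invariance moves the interval to \<open>[0, N]\<close>. As \<open>h\<close> is
  blind to the sites beyond \<open>n\<close>, the sum can be grouped by the symbol at
  \<open>n\<close>, and each group has total weight \<open>g_approx\<close>.\<close>

lemma kernel_interval:
  assumes h: "\<And>x y. agree {..n} x y \<Longrightarrow> h x = h y"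
  shows "spec_kernel \<phi> {n..n + int N} h x =
    (\<Sum>a\<in>UNIV. g_approx \<phi> N (shift_pow n (x(n := a))) * h (x(n := a)))"
proof -
  let ?\<Lambda> = "{n..n + int N}"
  let ?C = "cyl (- {0..int N}) (shift_pow n x)"
  have img: "(+) n ` {0..int N} = ?\<Lambda>" by simp
  have phi: "\<phi> ?\<Lambda> y = \<phi> {0..int N} (shift_pow n y)" for y
    using invar[unfolded shift_invariant_spec_def, rule_format, OF initial_interval_finite_nonempty, of n N y]
    unfolding img .
  have hy: "h y = (\<Sum>a\<in>UNIV. at0 a (shift_pow n y) * h (x(n := a)))" if "y \<in> cyl (- ?\<Lambda>) x" for y
  proof -
    have "h y = h (x(n := y n))"
      by (rule h, rule agreeI) (use that in \<open>auto simp: mem_cyl_Compl\<close>)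
    also have "\<dots> = (\<Sum>a\<in>UNIV. if y n = a then h (x(n := a)) else 0)" by simp
    also have "\<dots> = (\<Sum>a\<in>UNIV. at0 a (shift_pow n y) * h (x(n := a)))"
      by (rule sum.cong) (simp_all add: at0_def shift_pow_def)
    finally show ?thesis .
  qed
  have "spec_kernel \<phi> ?\<Lambda> h x = (\<Sum>y\<in>cyl (- ?\<Lambda>) x.
      \<phi> {0..int N} (shift_pow n y) * (\<Sum>a\<in>UNIV. at0 a (shift_pow n y) * h (x(n := a))))"
    unfolding spec_kernel_def by (intro sum.cong refl) (simp add: phi hy)
  also have "\<dots> = (\<Sum>y\<in>?C. \<phi> {0..int N} y * (\<Sum>a\<in>UNIV. at0 a y * h (x(n := a))))"
    by (rule sum.reindex_bij_witness[where i = "shift_pow (- n)" and j = "shift_pow n"])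
      (auto simp: mem_cyl_Compl shift_pow_def)
  also have "\<dots> = (\<Sum>a\<in>UNIV. (\<Sum>y\<in>?C. \<phi> {0..int N} y * at0 a y) * h (x(n := a)))"
    unfolding sum_distrib_left sum_distrib_right by (subst sum.swap) (simp add: mult_ac)
  also have "\<dots> = (\<Sum>a\<in>UNIV. g_approx \<phi> N (shift_pow n (x(n := a))) * h (x(n := a)))"
  proof (intro sum.cong refl)
    fix a
    have "cyl (- {0..int N}) (shift_pow n (x(n := a))) = ?C"
      unfolding shift_pow_upd by (rule cyl_cong, rule agreeI) auto
    then show "(\<Sum>y\<in>?C. \<phi> {0..int N} y * at0 a y) * h (x(n := a)) =
        g_approx \<phi> N (shift_pow n (x(n := a))) * h (x(n := a))"
      unfolding g_approx_at0 by (simp add: shift_pow_upd)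
  qed
  finally show ?thesis .
qed

end

section \<open>One-site kernels and the equivalence of Gibbs states and chains\<close>

context divergent_spec
begin

definition chain_kernel :: "int \<Rightarrow> ('s config \<Rightarrow> real) \<Rightarrow> 's config \<Rightarrow> real" where
  "chain_kernel n h x = (\<Sum>s\<in>UNIV. g (shift_pow n (x(n := s))) * h (x(n := s)))"

lemma chain_kernel_eq: "spec_kernel (\<lambda>_ y. g (shift_pow n y)) {n} h = chain_kernel n h"
  by (rule ext) (simp only: spec_kernel_def chain_kernel_def sum_cyl_singleton)

lemma g_shift_bounded_borel: "(\<lambda>y. g (shift_pow n y)) \<in> bounded_borel"
proof (rule bounded_borelI[where B = 1])
  show "(\<lambda>y. g (shift_pow n y)) \<in> borel_measurable borel"
    using continuous_on_compose2[OF g_cont continuous_on_shift_pow]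
    by (intro borel_measurable_continuous_onI) simp
  show "\<bar>g (shift_pow n y)\<bar> \<le> 1" for y
    using g_pos[of "shift_pow n y"] g_le_1[of "shift_pow n y"] by simp
qed

lemma g_shift_agree:
  assumes "agree {..n} x y"
  shows "g (shift_pow n x) = g (shift_pow n y)"
  by (rule g_agree, rule agreeI) (use agreeD[OF assms] in \<open>simp add: shift_pow_def\<close>)

lemma g_shift_sum: "(\<Sum>y\<in>cyl (- {n}) x. g (shift_pow n y)) = 1"
  unfolding sum_cyl_singleton shift_pow_upd by (rule g_sum)

lemma chain_kernel_bounded_borel:
  assumes "h \<in> bounded_borel"
  shows "chain_kernel n h \<in> bounded_borel"
proof -
  have b: "(\<lambda>y. g (shift_pow n y) * h y) \<in> bounded_borel"
    by (rule bounded_borel_mult[OF g_shift_bounded_borel assms])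
  then obtain B where B: "\<And>y. \<bar>g (shift_pow n y) * h y\<bar> \<le> B"
    by (rule bounded_borelE) blast
  have eq: "x(n := s) = override_on x (\<lambda>_. s) {n}" for x :: "'s config" and s
    by (auto simp: override_on_def)
  show ?thesis
  proof (rule bounded_borelI)
    have "(\<lambda>x. g (shift_pow n (x(n := s))) * h (x(n := s))) \<in> borel_measurable borel" for s
      using bounded_borel_override[OF b, of "\<lambda>_. s" "{n}"] unfolding eq by (simp add: bounded_borel_def)
    then show "chain_kernel n h \<in> borel_measurable borel"
      unfolding chain_kernel_def[abs_def] by (rule borel_measurable_sum)
    show "\<bar>chain_kernel n h x\<bar> \<le> (\<Sum>s\<in>(UNIV :: 's set). B)" for x
      unfolding chain_kernel_def by (rule order_trans[OF sum_abs sum_mono]) (rule B)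
  qed
qed

text \<open>The sum over site \<open>n\<close> erases that coordinate, which is what allows one-site
  kernels to be iterated to the left.\<close>

lemma chain_kernel_agree:
  assumes h: "\<And>x y. agree {..n} x y \<Longrightarrow> h x = h y" and ag: "agree {..n - 1} x y"
  shows "chain_kernel n h x = chain_kernel n h y"
proof -
  have "agree {..n} (x(n := s)) (y(n := s))" for s
    by (rule agreeI) (use agreeD[OF ag] in auto)
  then show ?thesis
    unfolding chain_kernel_def by (intro sum.cong refl arg_cong2[where f = "(*)"] h g_shift_agree)
qed

lemma interval_Un: "{..n - 1} \<union> {n} = {..n :: int}"
  by auto

lemma chain_kernel_integral:
  assumes "prob_measure_on_X \<mu>" "g_chain g \<mu>" "h \<in> bounded_borel"
    and "\<And>x y. agree {..n} x y \<Longrightarrow> h x = h y"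
  shows "(\<integral>x. chain_kernel n h x \<partial>\<mu>) = (\<integral>x. h x \<partial>\<mu>)"
  unfolding chain_kernel_eq[symmetric]
proof (rule cond_prob_kernel(1)[OF assms(1), where \<Delta> = "{..n - 1}"])
  show "AE x in \<mu>. real_cond_exp \<mu> (coord_algebra {..n - 1}) (indicator (cyl {n} x)) x = g (shift_pow n x)"
    using assms(2) by (simp add: g_chain_def)
qed (simp_all only: interval_Un g_shift_sum g_shift_bounded_borel assms(3) less_imp_le[OF g_pos],
    auto intro: g_shift_agree assms(4))

lemma g_chainI:
  assumes \<mu>: "prob_measure_on_X \<mu>"
    and inv: "\<And>n B. B \<in> sets borel \<Longrightarrow> (\<And>x y. agree {..n} x y \<Longrightarrow> x \<in> B \<longleftrightarrow> y \<in> B) \<Longrightarrow>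
      (\<integral>x. chain_kernel n (indicator B) x \<partial>\<mu>) = measure \<mu> B"
  shows "g_chain g \<mu>"
  unfolding g_chain_def
proof (intro conjI allI \<mu>)
  fix n
  show "AE x in \<mu>. real_cond_exp \<mu> (coord_algebra {..n - 1}) (indicator (cyl {n} x)) x = g (shift_pow n x)"
  proof (rule cond_prob_kernel(2)[OF \<mu>])
    show "(\<integral>x. spec_kernel (\<lambda>_ y. g (shift_pow n y)) {n} (indicator B) x \<partial>\<mu>) = measure \<mu> B"
      if "B \<in> sets borel" "\<And>x y. agree ({..n - 1} \<union> {n}) x y \<Longrightarrow> x \<in> B \<longleftrightarrow> y \<in> B" for B
      unfolding chain_kernel_eq using that unfolding interval_Un by (rule inv)
  qed (simp_all only: interval_Un g_shift_sum g_shift_bounded_borel less_imp_le[OF g_pos],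
      auto intro: g_shift_agree)
qed

lemma kernel_tendsto_chain_kernel:
  assumes hb: "h \<in> bounded_borel" and h: "\<And>x y. agree {..n} x y \<Longrightarrow> h x = h y" and "0 < e"
  obtains N0 where "\<And>N x. N0 \<le> N \<Longrightarrow> \<bar>spec_kernel \<phi> {n..n + int N} h x - chain_kernel n h x\<bar> < e"
proof -
  obtain B where B: "\<And>x. \<bar>h x\<bar> \<le> B" using hb by (rule bounded_borelE) blast
  then have "0 \<le> B" using order_trans[OF abs_ge_zero] by blast
  \<comment> \<open>There are \<open>CARD('s)\<close> errors of size at most
    \<open>e / c * B\<close>, together \<open>e * ((c - 1) / c) < e\<close>; the summand
    \<open>1\<close> also keeps \<open>c\<close> positive for \<open>B = 0\<close>.\<close>
  define c where "c = real CARD('s) * B + 1"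
  have c: "0 < c" unfolding c_def using \<open>0 \<le> B\<close> by (intro add_nonneg_pos mult_nonneg_nonneg) auto
  have "0 < e / c" using c \<open>0 < e\<close> by simp
  then obtain N0 where N0: "\<And>N x. N0 \<le> N \<Longrightarrow> dist (g_approx \<phi> N x) (g x) < e / c"
    using g_uniform unfolding uniform_limit_sequentially_iff by (metis UNIV_I)
  show thesis
  proof (rule that[of N0])
    fix N x assume N: "N0 \<le> N"
    have ker: "spec_kernel \<phi> {n..n + int N} h x =
        (\<Sum>a\<in>UNIV. g_approx \<phi> N (shift_pow n (x(n := a))) * h (x(n := a)))"
      by (rule kernel_interval) (rule h)
    have "\<bar>spec_kernel \<phi> {n..n + int N} h x - chain_kernel n h x\<bar> =
        \<bar>\<Sum>a\<in>UNIV. (g_approx \<phi> N (shift_pow n (x(n := a))) - g (shift_pow n (x(n := a)))) * h (x(n := a))\<bar>"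
      unfolding ker chain_kernel_def
      by (simp add: sum_subtractf[symmetric] left_diff_distrib)
    also have "\<dots> \<le> (\<Sum>a\<in>(UNIV :: 's set). e / c * B)"
    proof (rule order_trans[OF sum_abs sum_mono])
      fix a
      show "\<bar>(g_approx \<phi> N (shift_pow n (x(n := a))) - g (shift_pow n (x(n := a)))) * h (x(n := a))\<bar>
          \<le> e / c * B"
        unfolding abs_mult using N0[OF N, of "shift_pow n (x(n := a))"] B[of "x(n := a)"] \<open>0 < e / c\<close>
        by (intro mult_mono) (auto simp: dist_real_def)
    qed
    also have "\<dots> = e * ((c - 1) / c)" by (simp add: c_def)
    also have "\<dots> < e * 1"
      using c \<open>0 < e\<close> by (intro mult_strict_left_mono) (auto simp: divide_less_eq)
    finally show "\<bar>spec_kernel \<phi> {n..n + int N} h x - chain_kernel n h x\<bar> < e" by simp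
  qed
qed

lemma interval_in_finite_nonempty: "a \<le> b \<Longrightarrow> {a..b} \<in> finite_nonempty"
  by (simp add: finite_nonempty_def)

text \<open>The kernels of \<open>[n, n + N]\<close> preserve \<open>\<mu>\<close> and converge
  uniformly to the one-site kernel at \<open>n\<close> on functions of the coordinates up to
  \<open>n\<close>, so that kernel inherits the invariance.\<close>

lemma gibbs_imp_chain:
  assumes \<mu>: "prob_measure_on_X \<mu>" and gibbs: "gibbs_state \<phi> \<mu>"
  shows "g_chain g \<mu>"
proof (rule g_chainI[OF \<mu>])
  interpret prob_space \<mu> using \<mu> by (simp add: prob_measure_on_X_def)
  fix n :: int and B :: "'s config set"
  assume B: "B \<in> sets borel" and inv: "\<And>x y. agree {..n} x y \<Longrightarrow> x \<in> B \<longleftrightarrow> y \<in> B"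
  let ?h = "indicator B :: 's config \<Rightarrow> real"
  have hb: "?h \<in> bounded_borel" by (rule bounded_borel_indicator[OF B])
  have h: "?h x = ?h y" if "agree {..n} x y" for x y
    using inv[OF that] by (simp add: indicator_def)
  have int: "(\<integral>x. ?h x \<partial>\<mu>) = measure \<mu> B"
    using B \<mu> by (simp add: prob_measure_on_X_def sets_eq_imp_space_eq[of \<mu> borel])
  have "\<bar>measure \<mu> B - (\<integral>x. chain_kernel n ?h x \<partial>\<mu>)\<bar> \<le> e" if "0 < e" for e
  proof -
    obtain N where N: "\<And>x. \<bar>spec_kernel \<phi> {n..n + int N} ?h x - chain_kernel n ?h x\<bar> < e"
      using kernel_tendsto_chain_kernel[OF hb h \<open>0 < e\<close>] by (metis order_refl)
    have "(\<integral>x. spec_kernel \<phi> {n..n + int N} ?h x \<partial>\<mu>) = measure \<mu> B"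
      using gibbs_kernel[OF \<mu> gibbs _ hb, of "{n..n + int N}"] int
      by (simp add: interval_in_finite_nonempty)
    then show ?thesis
      using prob_integral_close[OF \<mu> kernel_bounded_borel[OF _ hb] chain_kernel_bounded_borel[OF hb]
          less_imp_le[OF N]] by (simp add: interval_in_finite_nonempty)
  qed
  then show "(\<integral>x. chain_kernel n ?h x \<partial>\<mu>) = measure \<mu> B"
    using field_le_epsilon[of "\<bar>measure \<mu> B - (\<integral>x. chain_kernel n ?h x \<partial>\<mu>)\<bar>" 0] by auto
qed

text \<open>The function \<open>k\<close> is the image of \<open>h\<close> under the one-site kernels at \<open>M, M - 1, \<dots>, M + 1 - d\<close>.\<close>

lemma chain_kernel_limit:
  assumes \<mu>: "prob_measure_on_X \<mu>" and chain: "g_chain g \<mu>"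
    and hb: "h \<in> bounded_borel" and h: "\<And>x y. agree {..M} x y \<Longrightarrow> h x = h y"
  shows "\<exists>k\<in>bounded_borel. (\<forall>x y. agree {..M - int d} x y \<longrightarrow> k x = k y) \<and>
    (\<integral>x. k x \<partial>\<mu>) = (\<integral>x. h x \<partial>\<mu>) \<and>
    (\<forall>e>0. \<exists>L0. \<forall>L\<ge>L0. \<forall>x. \<bar>spec_kernel \<phi> {M + 1 - int d..M + 1 + int L} h x - k x\<bar> < e)"
proof (induction d)
  case 0
  \<comment> \<open>For \<open>d = 0\<close> the interval starts to the right of everything that
    \<open>h\<close> sees.\<close>
  have "spec_kernel \<phi> {M + 1..M + 1 + int L} h x = h x" for L x
  proof (rule kernel_fixed)
    fix y assume "y \<in> cyl (- {M + 1..M + 1 + int L}) x"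
    then show "h y = h x" by (intro h agreeI) (simp add: mem_cyl_Compl)
  qed (simp add: interval_in_finite_nonempty)
  then show ?case using hb h by (intro bexI[of _ h]) auto
next
  case (Suc d)
  then obtain k where kb: "k \<in> bounded_borel" and k: "\<And>x y. agree {..M - int d} x y \<Longrightarrow> k x = k y"
    and int: "(\<integral>x. k x \<partial>\<mu>) = (\<integral>x. h x \<partial>\<mu>)"
    and lim: "\<And>e. 0 < e \<Longrightarrow>
      \<exists>L0. \<forall>L\<ge>L0. \<forall>x. \<bar>spec_kernel \<phi> {M + 1 - int d..M + 1 + int L} h x - k x\<bar> < e"
    by auto
  define n where "n = M - int d"
  have n: "M + 1 - int (Suc d) = n" "M + 1 - int d = n + 1" "M - int (Suc d) = n - 1"
    by (simp_all add: n_def)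
  show ?case
  proof (intro bexI[of _ "chain_kernel n k"] conjI allI impI)
    show "chain_kernel n k \<in> bounded_borel" by (rule chain_kernel_bounded_borel[OF kb])
    show "chain_kernel n k x = chain_kernel n k y" if "agree {..M - int (Suc d)} x y" for x y
    proof (rule chain_kernel_agree)
      show "agree {..n - 1} x y" using that unfolding n .
    qed (rule k[folded n_def])
    show "(\<integral>x. chain_kernel n k x \<partial>\<mu>) = (\<integral>x. h x \<partial>\<mu>)"
      using chain_kernel_integral[OF \<mu> chain kb k[folded n_def]] int by simp
    fix e :: real assume "0 < e"
    then have "0 < e / 2" by simp
    obtain L1 where L1: "\<And>L x. L1 \<le> L \<Longrightarrow>
        \<bar>spec_kernel \<phi> {n + 1..M + 1 + int L} h x - k x\<bar> < e / 2"
      using lim[OF \<open>0 < e / 2\<close>] unfolding n by blast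
    obtain N0 where N0: "\<And>N x. N0 \<le> N \<Longrightarrow>
        \<bar>spec_kernel \<phi> {n..n + int N} k x - chain_kernel n k x\<bar> < e / 2"
      using kernel_tendsto_chain_kernel[OF kb k[folded n_def] \<open>0 < e / 2\<close>] by blast
    show "\<exists>L0. \<forall>L\<ge>L0. \<forall>x.
        \<bar>spec_kernel \<phi> {M + 1 - int (Suc d)..M + 1 + int L} h x - chain_kernel n k x\<bar> < e"
      unfolding n
    proof (intro exI[of _ "max L1 N0"] allI impI)
      fix L x assume L: "max L1 N0 \<le> L"
      let ?T = "M + 1 + int L"
      have T: "?T = n + int (L + d + 1)" by (simp add: n_def)
      have fn: "{n..?T} \<in> finite_nonempty" by (simp add: interval_in_finite_nonempty n_def)
      \<comment> \<open>Consistency inserts the kernel of \<open>[n + 1, T]\<close>, which is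
        uniformly close to \<open>k\<close> by induction. Since \<open>k\<close> depends on
        coordinates up to \<open>n\<close> only, the outer kernel then converges to the one-site
        kernel.\<close>
      have "spec_kernel \<phi> {n..?T} h x = spec_kernel \<phi> {n..?T} (spec_kernel \<phi> {n + 1..?T} h) x"
        by (rule kernel_consistent[OF fn, symmetric]) (auto simp: n_def)
      moreover have "\<bar>spec_kernel \<phi> {n..?T} (spec_kernel \<phi> {n + 1..?T} h) x - spec_kernel \<phi> {n..?T} k x\<bar> \<le> e / 2"
        using L1 L by (intro kernel_close[OF fn] less_imp_le) auto
      moreover have "\<bar>spec_kernel \<phi> {n..?T} k x - chain_kernel n k x\<bar> < e / 2"
        unfolding T by (rule N0) (use L in simp)
      ultimately show "\<bar>spec_kernel \<phi> {n..?T} h x - chain_kernel n k x\<bar> < e"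
        by linarith
    qed
  qed
qed

text \<open>The kernel of an interval containing \<open>\<Lambda>\<close> takes the same values on
  \<open>h\<close> and on \<open>k\<close>, by consistency. Under a chain, kernels of intervals
  extending far to the right almost preserve integrals of functions of a left half-line, so
  \<open>h\<close> and \<open>k\<close> have equal integrals.\<close>

lemma chain_imp_gibbs:
  assumes \<mu>: "prob_measure_on_X \<mu>" and chain: "g_chain g \<mu>"
  shows "gibbs_state \<phi> \<mu>"
proof (rule gibbs_stateI[OF \<mu>])
  interpret prob_space \<mu> using \<mu> by (simp add: prob_measure_on_X_def)
  fix \<Lambda> D :: "int set" and w :: "'s config"
  assume \<Lambda>: "\<Lambda> \<in> finite_nonempty" and D: "finite D"
  define h :: "'s config \<Rightarrow> real" where "h = indicator (cyl D w)"
  define k where "k = spec_kernel \<phi> \<Lambda> h"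
  have cylb: "cyl D w \<in> sets borel"
    using cyl_in_coord_algebra[OF D, of UNIV] coord_algebra_subset_borel by blast
  have hb: "h \<in> bounded_borel" unfolding h_def by (rule bounded_borel_indicator[OF cylb])
  have kb: "k \<in> bounded_borel" unfolding k_def by (rule kernel_bounded_borel[OF \<Lambda> hb])
  have kc: "continuous_on UNIV k"
    unfolding k_def h_def by (rule kernel_cont[OF \<Lambda> continuous_on_indicator_cyl[OF D]])
  have "finite (\<Lambda> \<union> D)" using \<Lambda> D by (simp add: finite_nonempty_def)
  then obtain b :: nat where b: "\<Lambda> \<union> D \<subseteq> {- int b..int b}" by (rule finite_int_interval)
  have close: "\<bar>(\<integral>x. k x \<partial>\<mu>) - (\<integral>x. h x \<partial>\<mu>)\<bar> \<le> 4 * e" if "0 < e" for e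
  proof -
    obtain n :: nat where n: "\<And>x y. agree {- int n..int n} x y \<Longrightarrow> \<bar>k x - k y\<bar> < e"
      using uniformly_continuous_config[OF kc \<open>0 < e\<close>] by blast
    \<comment> \<open>\<open>M\<close> lies to the right of \<open>D\<close> and is at least
      \<open>n\<close>; \<open>d\<close> is chosen so that the interval of the kernels starts at
      \<open>-b\<close>.\<close>
    define M where "M = int (n + b)"
    define d where "d = n + 2 * b + 1"
    have left_end: "M + 1 - int d = - int b" by (simp add: M_def d_def)
    \<comment> \<open>\<open>k\<close> may depend on coordinates beyond \<open>M\<close>; freezing
      them at those of \<open>w\<close> costs at most \<open>e\<close>, by uniform
      continuity.\<close>
    define k' where "k' x = k (override_on x w {M<..})" for x
    have k'b: "k' \<in> bounded_borel" unfolding k'_def by (rule bounded_borel_override[OF kb])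
    have kk': "\<bar>k x - k' x\<bar> \<le> e" for x
      unfolding k'_def by (intro less_imp_le n agreeI) (auto simp: M_def)
    have k'_agree: "k' x = k' y" if "agree {..M} x y" for x y
    proof -
      have "override_on x w {M<..} = override_on y w {M<..}"
        using agreeD[OF that] by (auto simp: override_on_def fun_eq_iff)
      then show ?thesis by (simp add: k'_def)
    qed
    have h_agree: "h x = h y" if ag: "agree {..M} x y" for x y
    proof -
      have "agree D x y" by (rule agree_mono[OF ag]) (use b in \<open>auto simp: M_def\<close>)
      then have "x \<in> cyl D w \<longleftrightarrow> y \<in> cyl D w"
        unfolding cyl_def mem_Collect_eq by (rule fun_cong[OF agree_cong])
      then show ?thesis by (simp add: h_def indicator_def)
    qed
    define K where "K L = spec_kernel \<phi> {- int b..M + 1 + int L}" for L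
    have fn: "{- int b..M + 1 + int L} \<in> finite_nonempty" for L
      by (simp add: interval_in_finite_nonempty M_def)
    obtain h1 where h1: "h1 \<in> bounded_borel" "(\<integral>x. h1 x \<partial>\<mu>) = (\<integral>x. h x \<partial>\<mu>)"
      and "\<And>e. 0 < e \<Longrightarrow> \<exists>L0. \<forall>L\<ge>L0. \<forall>x. \<bar>K L h x - h1 x\<bar> < e"
      using chain_kernel_limit[where M = M and d = d, OF \<mu> chain hb] h_agree unfolding left_end K_def by blast
    then obtain L1 where L1: "\<And>L x. L1 \<le> L \<Longrightarrow> \<bar>K L h x - h1 x\<bar> < e"
      using \<open>0 < e\<close> by blast
    obtain k1 where k1: "k1 \<in> bounded_borel" "(\<integral>x. k1 x \<partial>\<mu>) = (\<integral>x. k' x \<partial>\<mu>)"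
      and "\<And>e. 0 < e \<Longrightarrow> \<exists>L0. \<forall>L\<ge>L0. \<forall>x. \<bar>K L k' x - k1 x\<bar> < e"
      using chain_kernel_limit[where M = M and d = d, OF \<mu> chain k'b] k'_agree unfolding left_end K_def by blast
    then obtain L2 where L2: "\<And>L x. L2 \<le> L \<Longrightarrow> \<bar>K L k' x - k1 x\<bar> < e"
      using \<open>0 < e\<close> by blast
    define L where "L = max L1 L2"
    have bb: "K L j \<in> bounded_borel" if "j \<in> bounded_borel" for j
      unfolding K_def by (rule kernel_bounded_borel[OF fn that])
    have "\<Lambda> \<subseteq> {- int b..M + 1 + int L}" using b by (auto simp: M_def)
    then have Kk: "K L k = K L h"
      unfolding K_def k_def using \<Lambda>
      by (intro ext kernel_consistent[OF fn]) (auto simp: finite_nonempty_def)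
    \<comment> \<open>The chain of integrals is \<open>k\<close>, \<open>k'\<close>,
      \<open>k1\<close>, \<open>K L k'\<close>, \<open>K L k = K L h\<close>, \<open>h1\<close>,
      \<open>h\<close>. Two links besides \<open>Kk\<close> are equalities; the other four cost
      \<open>e\<close> each.\<close>
    have "\<bar>(\<integral>x. k x \<partial>\<mu>) - (\<integral>x. k' x \<partial>\<mu>)\<bar> \<le> e"
      by (rule prob_integral_close[OF \<mu> kb k'b kk'])
    moreover have "\<bar>(\<integral>x. K L k' x \<partial>\<mu>) - (\<integral>x. k1 x \<partial>\<mu>)\<bar> \<le> e"
      by (rule prob_integral_close[OF \<mu> bb[OF k'b] k1(1)]) (simp add: less_imp_le L2 L_def)
    moreover have "\<bar>(\<integral>x. K L k x \<partial>\<mu>) - (\<integral>x. K L k' x \<partial>\<mu>)\<bar> \<le> e"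
      by (rule prob_integral_close[OF \<mu> bb[OF kb] bb[OF k'b]])
        (unfold K_def, rule kernel_close[OF fn kk'])
    moreover have "\<bar>(\<integral>x. K L h x \<partial>\<mu>) - (\<integral>x. h1 x \<partial>\<mu>)\<bar> \<le> e"
      by (rule prob_integral_close[OF \<mu> bb[OF hb] h1(1)]) (simp add: less_imp_le L1 L_def)
    ultimately show ?thesis
      unfolding Kk h1(2) k1(2) by linarith
  qed
  have "\<bar>(\<integral>x. k x \<partial>\<mu>) - (\<integral>x. h x \<partial>\<mu>)\<bar> \<le> 0"
  proof (rule field_le_epsilon)
    fix e :: real assume "0 < e"
    then show "\<bar>(\<integral>x. k x \<partial>\<mu>) - (\<integral>x. h x \<partial>\<mu>)\<bar> \<le> 0 + e" using close[of "e / 4"] by simp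
  qed
  then have "(\<integral>x. k x \<partial>\<mu>) = (\<integral>x. h x \<partial>\<mu>)" by simp
  also have "\<dots> = measure \<mu> (cyl D w)"
    using cylb \<mu> by (simp add: h_def prob_measure_on_X_def sets_eq_imp_space_eq[of \<mu> borel])
  finally show "(\<integral>x. spec_kernel \<phi> \<Lambda> (indicator (cyl D w)) x \<partial>\<mu>) = measure \<mu> (cyl D w)"
    by (simp add: k_def h_def)
qed

lemma g_in_G_functions: "g \<in> G_functions"
proof -
  have borel: "g \<in> borel_measurable borel" by (rule borel_measurable_continuous_onI[OF g_cont])
  have "\<bar>g x\<bar> \<le> 1" for x using g_pos[of x] g_le_1[of x] by simp
  with borel have "g \<in> bounded_borel" by (rule bounded_borelI)
  moreover have "g \<in> borel_measurable (coord_algebra {..0})"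
    by (rule measurable_coord_algebraI[OF borel g_agree])
  ultimately show ?thesis
    unfolding G_functions_def using g_pos g_sum by (auto intro: less_imp_le)
qed

end

theorem theorem4p2:
  fixes \<phi> :: "int set \<Rightarrow> (int \<Rightarrow> 's::{finite,discrete_topology}) \<Rightarrow> real"
    and f :: "nat \<Rightarrow> (int \<Rightarrow> 's) \<Rightarrow> real"
  assumes "is_specification \<phi>"
    and "positive_spec \<phi>"
    and "continuous_spec \<phi>"
    and "shift_invariant_spec \<phi>"
    and "spec_sequence_for \<phi> f"
    and "(\<Sum>k. \<Prod>j\<le>k. INF i. rinf {..int i + int j} (f i)) = \<infinity>"
  shows "(\<forall>x. convergent (\<lambda>n. g_approx \<phi> n x)) \<and>
    uniform_limit UNIV (g_approx \<phi>) (g_of_spec \<phi>) sequentially \<and>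
    (\<forall>x. g_of_spec \<phi> x > 0) \<and>
    g_of_spec \<phi> \<in> G_functions \<and>
    continuous_on UNIV (g_of_spec \<phi>) \<and>
    (\<forall>n. rsup {- int n..0} (g_of_spec \<phi>) \<le> (1 + inverse (R_sum f n))\<^sup>2) \<and>
    (\<forall>\<mu>. prob_measure_on_X \<mu> \<longrightarrow> (gibbs_state \<phi> \<mu> \<longleftrightarrow> g_chain (g_of_spec \<phi>) \<mu>))"
proof -
  interpret sequenced_spec \<phi> f by unfold_locales (fact assms)+
  have "{..<0} \<union> {0..int i + int j} = {..int i + int j}" for i j by auto
  then have "(\<Sum>k. \<Prod>j\<le>k. inf_variation {..<0} j) = \<infinity>" unfolding inf_variation_def using assms(6) by simp
  then interpret divergent_spec \<phi> f by unfold_locales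
  show ?thesis
    using g_tendsto g_uniform g_pos g_in_G_functions g_cont g_rsup gibbs_imp_chain chain_imp_gibbs
    by (auto simp: convergent_def)
qed

end
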